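(* Let $\rho_0\in X$ be given and let $\delta x,\delta t>0$ be given constants. Consider the sequence $\{\rho_i^k: i,k\in\mathbb{Z},k\ge0\}$ defined by the recursive formula $$\rho_i^{k+1}=\rho_i^k+\frac{\delta t}{\delta x}\left(\rho_{i-1}^kh\left(\frac{Q'(\rho_{i-1}^k)-Q'(\rho_i^k)}{\delta x}\right)-\rho_i^kh\left(\frac{Q'(\rho_i^k)-Q'(\rho_{i+1}^k)}{\delta x}\right)\right),\quad i,k\in\mathbb{Z},\ k\ge0,$$ with $\rho_i^0=\frac1{\delta x}\int_{i\delta x}^{(i+1)\delta x}\rho_0(s)\,ds$ for $i\in\mathbb{Z}$. (I) Assume the recursion is well defined, i.e. $\rho_i^k\in[0,R)$ for all $i,k\in\mathbb{Z}$, $k\ge0$. Define $\rho_{\delta x,\delta t},w_{\delta x,\delta t}:\mathbb{R}_+\times\mathbb{R}\to\mathbb{R}$ by $$\rho_{\delta x,\delta t}(t,x)=\rho_i^k,\qquad w_{\delta x,\delta t}(t,x)=w_i^k=h\left(\frac{Q'(\rho_i^k)-Q'(\rho_{i+1}^k)}{\delta x}\right)$$ for $x\in[i\delta x,(i+1)\delta x)$, $t\in[k\delta t,(k+1)\delta t)$, $i,k\in\mathbb{Z}$, $k\ge0$. Then for every function $\phi\in C^2(\mathbb{R}_+\times\mathbb{R})$ of compact support the following equations hold: $$\int_{-\infty}^{+\infty}\rho_{\delta x,\delta t}(t,x)\,dx=\int_{-\infty}^{+\infty}\rho_0(x)\,dx\quad\text{for all }t\ge0,$$ $$-\int_{-\infty}^{+\infty}\phi(0,x)\rho_0(x)\,dx=\int_0^{+\infty}\int_{-\infty}^{+\infty}\rho_{\delta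 x,\delta t}(t,x)\left(w_{\delta x,\delta t}(t,x)\phi_x(t,x)+\phi_t(t,x)\right)dx\,dt+P_1,$$ $$\int_0^{+\infty}\int_{-\infty}^{+\infty}\left(\phi(t,x)\beta(w_{\delta x,\delta t}(t,x))-\phi_x(t,x)Q'(\rho_{\delta x,\delta t}(t,x))\right)dx\,dt=P_2,$$ where $$\begin{aligned} P_1:=&-\sum_{i\in\mathbb{Z}}\int_0^{\delta t}\int_{i\delta x}^{(i+1)\delta x}\phi_t(0,i\delta x)\rho_{\delta x,\delta t}(t,x)\,dx\,dt\\ &+\delta t\sum_{k\ge0}\sum_{i\in\mathbb{Z}}\rho_{i-1}^kw_{i-1}^k\int_{(i-1)\delta x}^{i\delta x}\int_{(i-1)\delta x}^{\xi}\phi_{xx}(k\delta t,s)\,ds\,d\xi\\ &+\delta x\sum_{k\ge0}\sum_{i\in\mathbb{Z}}\rho_i^{k+1}\int_{k\delta t}^{(k+1)\delta t}\int_{k\delta t}^{\tau}\phi_{tt}(l,i\delta x)\,dl\,d\tau-\sum_{i\in\mathbb{Z}}\int_{i\delta x}^{(i+1)\delta x}\int_{i\delta x}^{x}\rho_0(x)\phi_x(0,l)\,dl\,dx\\ &-\sum_{k\ge0}\sum_{i\in\mathbb{Z}}\int_{k\delta t}^{(k+1)\delta t}\int_{i\delta x}^{(i+1)\delta x}\left(\int_{i\delta x}^{x}\phi_{tx}(t,s)\,ds+\int_{k\delta t}^{t}\phi_{tt}(\tau,i\delta x)\,d\tau\right)\rho_{\delta x,\delta t}(t,x)\,dx\,dt\\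 &-\sum_{k\ge0}\sum_{i\in\mathbb{Z}}\int_{k\delta t}^{(k+1)\delta t}\int_{(i-1)\delta x}^{i\delta x}\left(\int_{(i-1)\delta x}^{x}\phi_{xx}(t,s)\,ds+\int_{k\delta t}^{t}\phi_{xt}(\tau,(i-1)\delta x)\,d\tau\right)\rho_{\delta x,\delta t}(t,x)w_{\delta x,\delta t}(t,x)\,dx\,dt\\ &-\sum_{k\ge0}\sum_{i\in\mathbb{Z}}\int_{(k+1)\delta t}^{(k+2)\delta t}\int_{i\delta x}^{(i+1)\delta x}\left(\int_{k\delta t}^{(k+1)\delta t}\phi_{tt}(\tau,i\delta x)\,d\tau\right)\rho_{\delta x,\delta t}(t,x)\,dx\,dt \end{aligned}$$ and $$\begin{aligned} P_2:=&-\sum_{k\ge0}\sum_{i\in\mathbb{Z}}\int_{k\delta t}^{(k+1)\delta t}\int_{i\delta x}^{(i+1)\delta x}\left(\int_{i\delta x}^{x}\phi_{xx}(t,s)\,ds\right)Q'(\rho_{\delta x,\delta t}(t,x))\,dx\,dt\\ &+\sum_{k\ge0}\sum_{i\in\mathbb{Z}}\int_{k\delta t}^{(k+1)\delta t}\int_{i\delta x}^{(i+1)\delta x}\left(\int_{k\delta t}^{t}\phi_t(\tau,i\delta x)\,d\tau+\int_{i\delta x}^{x}\phi_x(t,\xi)\,d\xi\right)\beta(w_{\delta x,\delta t}(t,x))\,dx\,dt\\ &-\sum_{k\ge0}\sum_{i\in\mathbb{Z}}\int_{k\delta t}^{(k+1)\delta t}\int_{(i+1)\delta x}^{(i+2)\delta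 x}\left(\int_{i\delta x}^{(i+1)\delta x}\phi_{xx}(t,s)\,ds+\int_{k\delta t}^{t}\phi_{xt}(\tau,i\delta x)\,d\tau\right)Q'(\rho_{\delta x,\delta t}(t,x))\,dx\,dt\\ &+\delta t\sum_{k\ge0}\sum_{i\in\mathbb{Z}}Q'(\rho_{i+1}^k)\int_{i\delta x}^{(i+1)\delta x}\int_{i\delta x}^{\xi}\phi_{xx}(k\delta t,s)\,ds\,d\xi . \end{aligned}$$ (II) Furthermore, if $$1\ge\frac{\delta t}{\delta x}\left(b+2\frac{\|\rho_0\|_\infty\|h'\|_\infty}{\delta x}\max_{0\le\rho\le\|\rho_0\|_\infty}(\kappa(\rho))\right)\quad\text{and}\quad 1\ge\delta t\frac{4\|\rho_0\|_\infty\|h'\|_\infty}{(\delta x)^2}\max_{0\le\rho\le\|\rho_0\|_\infty}(\kappa(\rho)),$$ then the recursion is well defined (all $\rho_i^k\in[0,R)$) and we also have for all $t\ge0$: $$\int_{-\infty}^{+\infty}Q(\rho_{\delta x,\delta t}(t,x))\,dx\le\int_{-\infty}^{+\infty}Q(\rho_0(x))\,dx,$$ $$0=\inf_{x\in\mathbb{R}}(\rho_{\delta x,\delta t}(t,x))\le\sup_{x\in\mathbb{R}}(\rho_{\delta x,\delta t}(t,x))\le\|\rho_0\|_\infty.$$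
   Context: $\mathbb{R}_+=[0,+\infty)$. Constants: $R>1$, $b>0$. The function $\kappa\in C^1([0,R);[0,+\infty))$ satisfies $\kappa(\rho)=0$ for $\rho\in[0,1]$ and $\kappa(\rho)>0$ for $\rho\in(1,R)$. The function $h\in C^1(\mathbb{R};(-1,b))$ satisfies $h'\in L^\infty(\mathbb{R})$, $h(0)=0$, $h'(s)>0$ for all $s\in\mathbb{R}$, and is onto $(-1,b)$; $\beta:(-1,b)\to\mathbb{R}$ denotes the inverse of $h$. Define $Q(\rho)=\int_1^\rho(\rho-\tau)\kappa(\tau)\,d\tau$ for $\rho\in[0,R)$, so $Q'(\rho)=\int_1^\rho\kappa(\tau)\,d\tau$. The set $X$ is $$X=\left\{\rho\in L^1(\mathbb{R})\cap L^\infty(\mathbb{R}):\ \inf_{x\in\mathbb{R}}\rho(x)=0,\ \sup_{x\in\mathbb{R}}\rho(x)<R,\ \lim_{x\to\pm\infty}\rho(x)=0\right\}.$$ Compact support of $\phi$ is meant in $[0,+\infty)\times\mathbb{R}$ (so $\phi(0,\cdot)$ need not vanish). $\|\cdot\|_\infty$ is the (essential) supremum norm on $\mathbb{R}$. *)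

theory Defs
  imports "HOL-Analysis.Analysis" "HOL-Probability.Essential_Supremum"
begin

section \<open>Function spaces\<close>

text \<open>At a point of \<^term>\<open>S\<close> on the boundary of \<^term>\<open>S\<close> the derivative is one-sided, so the
  values of \<^term>\<open>f\<close> outside \<^term>\<open>S\<close> play no role.\<close>

definition C1_on :: "(real \<Rightarrow> real) \<Rightarrow> real set \<Rightarrow> bool" where
  "C1_on f S \<longleftrightarrow>
     (\<exists>f'. (\<forall>x\<in>S. (f has_real_derivative f' x) (at x within S)) \<and> continuous_on S f')"

definition linf_norm :: "(real \<Rightarrow> real) \<Rightarrow> real" where
  "linf_norm f = real_of_ereal (esssup lebesgue (\<lambda>x. ereal \<bar>f x\<bar>))"

definition in_Linf :: "(real \<Rightarrow> real) \<Rightarrow> bool" where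
  "in_Linf f \<longleftrightarrow> f \<in> borel_measurable lebesgue \<and> esssup lebesgue (\<lambda>x. ereal \<bar>f x\<bar>) < \<infinity>"

text \<open>The two boundedness conditions make the infimum and the supremum over \<^term>\<open>range \<rho>\<close>
  genuine ones (on type \<^typ>\<open>real\<close> they are unspecified for unbounded sets).\<close>

definition X_space :: "real \<Rightarrow> (real \<Rightarrow> real) set" where
  "X_space R =
     {\<rho>. integrable lebesgue \<rho> \<and> in_Linf \<rho> \<and>
         bdd_below (range \<rho>) \<and> (INF x. \<rho> x) = 0 \<and>
         bdd_above (range \<rho>) \<and> (SUP x. \<rho> x) < R \<and>
         (\<rho> \<longlongrightarrow> 0) at_top \<and> (\<rho> \<longlongrightarrow> 0) at_bot}"


section \<open>Test functions on the closed half plane\<close>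

text \<open>Functions of \<open>(t, x)\<close> with \<open>t \<ge> 0\<close> are curried. The time derivative is taken within
  \<open>[0, \<infinity>)\<close>, hence one-sided at \<open>t = 0\<close>. Mixed derivatives are read from left to right:
  \<open>\<phi>\<^sub>t\<^sub>x\<close> is \<open>D_x (D_t \<phi>)\<close> and \<open>\<phi>\<^sub>x\<^sub>t\<close> is \<open>D_t (D_x \<phi>)\<close>.\<close>

definition D_t :: "(real \<Rightarrow> real \<Rightarrow> real) \<Rightarrow> real \<Rightarrow> real \<Rightarrow> real" where
  "D_t \<phi> t x = vector_derivative (\<lambda>\<tau>. \<phi> \<tau> x) (at t within {0..})"

definition D_x :: "(real \<Rightarrow> real \<Rightarrow> real) \<Rightarrow> real \<Rightarrow> real \<Rightarrow> real" where
  "D_x \<phi> t x = vector_derivative (\<lambda>\<xi>. \<phi> t \<xi>) (at x)"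

definition cont_halfplane :: "(real \<Rightarrow> real \<Rightarrow> real) \<Rightarrow> bool" where
  "cont_halfplane \<phi> \<longleftrightarrow> continuous_on ({0..} \<times> UNIV) (\<lambda>(t, x). \<phi> t x)"

definition C1_halfplane :: "(real \<Rightarrow> real \<Rightarrow> real) \<Rightarrow> bool" where
  "C1_halfplane \<phi> \<longleftrightarrow>
     (\<forall>t\<ge>0. \<forall>x. (\<lambda>\<tau>. \<phi> \<tau> x) differentiable (at t within {0..})) \<and>
     (\<forall>t\<ge>0. \<forall>x. (\<lambda>\<xi>. \<phi> t \<xi>) differentiable (at x)) \<and>
     cont_halfplane \<phi> \<and> cont_halfplane (D_t \<phi>) \<and> cont_halfplane (D_x \<phi>)"

definition C2_halfplane :: "(real \<Rightarrow> real \<Rightarrow> real) \<Rightarrow> bool" where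
  "C2_halfplane \<phi> \<longleftrightarrow> C1_halfplane \<phi> \<and> C1_halfplane (D_t \<phi>) \<and> C1_halfplane (D_x \<phi>)"

definition compact_support_halfplane :: "(real \<Rightarrow> real \<Rightarrow> real) \<Rightarrow> bool" where
  "compact_support_halfplane \<phi> \<longleftrightarrow> compact (closure {(t, x). 0 \<le> t \<and> \<phi> t x \<noteq> 0})"


section \<open>The numerical scheme\<close>

definition Q :: "(real \<Rightarrow> real) \<Rightarrow> real \<Rightarrow> real" where
  "Q \<kappa> \<rho> = (LBINT \<tau>=1..\<rho>. (\<rho> - \<tau>) * \<kappa> \<tau>)"

definition Q' :: "(real \<Rightarrow> real) \<Rightarrow> real \<Rightarrow> real" where
  "Q' \<kappa> \<rho> = (LBINT \<tau>=1..\<rho>. \<kappa> \<tau>)"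

lemma has_real_derivative_Q:
  assumes "R > 1" "continuous_on {0..<R} \<kappa>" "\<rho> \<in> {0..<R}"
  shows "(Q \<kappa> has_real_derivative Q' \<kappa> \<rho>) (at \<rho> within {0..<R})"
proof -
  define c where "c = (max 1 \<rho> + R) / 2"
  have c: "1 < c" "\<rho> < c" "c < R" using assms by (auto simp: c_def max_def)
  have ck: "continuous_on {0..c} \<kappa>" using assms(2) by (rule continuous_on_subset) (use c in auto)
  have ck': "continuous_on {0..c} (\<lambda>\<tau>. \<tau> * \<kappa> \<tau>)" by (intro continuous_intros ck)
  have D1: "((\<lambda>u. LBINT \<tau>=1..u. \<kappa> \<tau>) has_real_derivative \<kappa> \<rho>) (at \<rho> within {0..c})"
    using interval_integral_FTC2[of 0 1 c \<kappa> \<rho>] c assms ck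
    by (auto simp: has_real_derivative_iff_has_vector_derivative one_ereal_def)
  have D2: "((\<lambda>u. LBINT \<tau>=1..u. \<tau> * \<kappa> \<tau>) has_real_derivative \<rho> * \<kappa> \<rho>) (at \<rho> within {0..c})"
    using interval_integral_FTC2[of 0 1 c "\<lambda>\<tau>. \<tau> * \<kappa> \<tau>" \<rho>] c assms ck'
    by (auto simp: has_real_derivative_iff_has_vector_derivative one_ereal_def)
  have eq: "Q \<kappa> u = u * (LBINT \<tau>=1..u. \<kappa> \<tau>) - (LBINT \<tau>=1..u. \<tau> * \<kappa> \<tau>)" if "u \<in> {0..c}" for u
  proof -
    have int: "interval_lebesgue_integrable lborel 1 (ereal u) g"
      if "continuous_on {0..c} g" for g :: "real \<Rightarrow> real"
    proof -
      have "set_integrable lborel {min 1 u..max 1 u} g"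
        by (rule borel_integrable_atLeastAtMost', rule continuous_on_subset[OF that])
           (use \<open>u \<in> {0..c}\<close> c in auto)
      then have "set_integrable lborel (einterval (min 1 u) (max 1 u)) g"
        by (rule set_integrable_subset) (auto simp: einterval_def min_def max_def split: if_splits)
      then show ?thesis
        by (auto simp: interval_lebesgue_integrable_def one_ereal_def min_def max_def
                 split: if_splits)
    qed
    have "Q \<kappa> u = (LBINT \<tau>=1..u. u * \<kappa> \<tau> - \<tau> * \<kappa> \<tau>)"
      by (simp add: Q_def algebra_simps)
    also have "\<dots> = (LBINT \<tau>=1..u. u * \<kappa> \<tau>) - (LBINT \<tau>=1..u. \<tau> * \<kappa> \<tau>)"
      by (intro interval_lebesgue_integral_diff int ck' continuous_intros ck)
    finally show ?thesis by simp
  qed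
  have "((\<lambda>u. u * (LBINT \<tau>=1..u. \<kappa> \<tau>) - (LBINT \<tau>=1..u. \<tau> * \<kappa> \<tau>)) has_real_derivative Q' \<kappa> \<rho>)
          (at \<rho> within {0..c})"
    by (rule derivative_eq_intros D1 D2 refl)+ (simp add: Q'_def)
  then have "(Q \<kappa> has_real_derivative Q' \<kappa> \<rho>) (at \<rho> within {0..c})"
    by (rule has_field_derivative_transform_within[OF _ zero_less_one]) (use c assms eq in auto)
  moreover have "at \<rho> within {0..c} = at \<rho> within {0..<R}"
    by (rule at_within_nhd[of _ "{..<c}"]) (use c in auto)
  ultimately show ?thesis by simp
qed

definition cell :: "real \<Rightarrow> int \<Rightarrow> real set" where
  "cell d j = {of_int j * d..of_int (j + 1) * d}"

text \<open>Outside \<open>[0, R)\<close> the function \<open>\<kappa>\<close>, hence \<^const>\<open>Q'\<close>, is arbitrary.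
  The recursion is well defined in the intended sense iff all values lie in \<open>[0, R)\<close>, and then
  they do not depend on how \<open>\<kappa>\<close> is extended.\<close>

primrec \<rho>_seq ::
  "(real \<Rightarrow> real) \<Rightarrow> (real \<Rightarrow> real) \<Rightarrow> real \<Rightarrow> real \<Rightarrow> (real \<Rightarrow> real) \<Rightarrow> nat \<Rightarrow> int \<Rightarrow> real" where
  "\<rho>_seq \<kappa> h \<delta>x \<delta>t \<rho>0 0 = (\<lambda>i. 1 / \<delta>x * (LINT s:cell \<delta>x i|lebesgue. \<rho>0 s))"
| "\<rho>_seq \<kappa> h \<delta>x \<delta>t \<rho>0 (Suc k) = (\<lambda>i. let r = \<rho>_seq \<kappa> h \<delta>x \<delta>t \<rho>0 k in
     r i + \<delta>t / \<delta>x *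
       (r (i - 1) * h ((Q' \<kappa> (r (i - 1)) - Q' \<kappa> (r i)) / \<delta>x)
        - r i * h ((Q' \<kappa> (r i) - Q' \<kappa> (r (i + 1))) / \<delta>x)))"

definition well_defined ::
  "real \<Rightarrow> (real \<Rightarrow> real) \<Rightarrow> (real \<Rightarrow> real) \<Rightarrow> real \<Rightarrow> real \<Rightarrow> (real \<Rightarrow> real) \<Rightarrow> bool" where
  "well_defined R \<kappa> h \<delta>x \<delta>t \<rho>0 \<longleftrightarrow> (\<forall>k i. \<rho>_seq \<kappa> h \<delta>x \<delta>t \<rho>0 k i \<in> {0..<R})"

definition w_seq ::
  "(real \<Rightarrow> real) \<Rightarrow> (real \<Rightarrow> real) \<Rightarrow> real \<Rightarrow> real \<Rightarrow> (real \<Rightarrow> real) \<Rightarrow> nat \<Rightarrow> int \<Rightarrow> real" where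
  "w_seq \<kappa> h \<delta>x \<delta>t \<rho>0 k i =
     h ((Q' \<kappa> (\<rho>_seq \<kappa> h \<delta>x \<delta>t \<rho>0 k i) - Q' \<kappa> (\<rho>_seq \<kappa> h \<delta>x \<delta>t \<rho>0 k (i + 1))) / \<delta>x)"

text \<open>\<open>grid_fun \<delta>x \<delta>t u\<close> equals \<open>u k i\<close> on \<open>[k \<delta>t, (k+1) \<delta>t) \<times> [i \<delta>x, (i+1) \<delta>x)\<close>.\<close>

definition grid_fun :: "real \<Rightarrow> real \<Rightarrow> (nat \<Rightarrow> int \<Rightarrow> real) \<Rightarrow> real \<Rightarrow> real \<Rightarrow> real" where
  "grid_fun \<delta>x \<delta>t u t x = u (nat \<lfloor>t / \<delta>t\<rfloor>) \<lfloor>x / \<delta>x\<rfloor>"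

lemma grid_fun_eq:
  assumes "\<delta>x > 0" "\<delta>t > 0"
    and "t \<in> {of_nat k * \<delta>t..<of_nat (k + 1) * \<delta>t}" "x \<in> {of_int i * \<delta>x..<of_int (i + 1) * \<delta>x}"
  shows "grid_fun \<delta>x \<delta>t u t x = u k i"
proof -
  have "\<lfloor>t / \<delta>t\<rfloor> = int k" "\<lfloor>x / \<delta>x\<rfloor> = i"
    using assms by (auto simp: floor_eq_iff field_simps)
  then show ?thesis by (simp add: grid_fun_def)
qed

definition \<rho>_grid ::
  "(real \<Rightarrow> real) \<Rightarrow> (real \<Rightarrow> real) \<Rightarrow> real \<Rightarrow> real \<Rightarrow> (real \<Rightarrow> real) \<Rightarrow> real \<Rightarrow> real \<Rightarrow> real" where
  "\<rho>_grid \<kappa> h \<delta>x \<delta>t \<rho>0 = grid_fun \<delta>x \<delta>t (\<rho>_seq \<kappa> h \<delta>x \<delta>t \<rho>0)"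

definition w_grid ::
  "(real \<Rightarrow> real) \<Rightarrow> (real \<Rightarrow> real) \<Rightarrow> real \<Rightarrow> real \<Rightarrow> (real \<Rightarrow> real) \<Rightarrow> real \<Rightarrow> real \<Rightarrow> real" where
  "w_grid \<kappa> h \<delta>x \<delta>t \<rho>0 = grid_fun \<delta>x \<delta>t (w_seq \<kappa> h \<delta>x \<delta>t \<rho>0)"


section \<open>The consistency errors\<close>

text \<open>For \<open>\<phi>\<close> of compact support all series below have only finitely many nonzero terms.\<close>

definition P1 ::
  "(real \<Rightarrow> real) \<Rightarrow> (real \<Rightarrow> real) \<Rightarrow> real \<Rightarrow> real \<Rightarrow> (real \<Rightarrow> real) \<Rightarrow> (real \<Rightarrow> real \<Rightarrow> real) \<Rightarrow> real"
where
  "P1 \<kappa> h \<delta>x \<delta>t \<rho>0 \<phi> =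
    (let r = \<rho>_seq \<kappa> h \<delta>x \<delta>t \<rho>0; w = w_seq \<kappa> h \<delta>x \<delta>t \<rho>0;
         \<rho>\<delta> = \<rho>_grid \<kappa> h \<delta>x \<delta>t \<rho>0; w\<delta> = w_grid \<kappa> h \<delta>x \<delta>t \<rho>0;
         \<phi>t = D_t \<phi>; \<phi>x = D_x \<phi>;
         \<phi>tt = D_t (D_t \<phi>); \<phi>tx = D_x (D_t \<phi>); \<phi>xt = D_t (D_x \<phi>); \<phi>xx = D_x (D_x \<phi>)
     in
     - (\<Sum>\<^sub>\<infinity>i::int. LINT t:{0..\<delta>t}|lebesgue. LINT x:cell \<delta>x i|lebesgue.
          \<phi>t 0 (of_int i * \<delta>x) * \<rho>\<delta> t x)
     + \<delta>t * (\<Sum>\<^sub>\<infinity>k::nat. \<Sum>\<^sub>\<infinity>i::int. r k (i - 1) * w k (i - 1) *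
          (LINT \<xi>:cell \<delta>x (i - 1)|lebesgue. LINT s:{of_int (i - 1) * \<delta>x..\<xi>}|lebesgue.
             \<phi>xx (of_nat k * \<delta>t) s))
     + \<delta>x * (\<Sum>\<^sub>\<infinity>k::nat. \<Sum>\<^sub>\<infinity>i::int. r (k + 1) i *
          (LINT \<tau>:cell \<delta>t (int k)|lebesgue. LINT l:{of_nat k * \<delta>t..\<tau>}|lebesgue.
             \<phi>tt l (of_int i * \<delta>x)))
     - (\<Sum>\<^sub>\<infinity>i::int. LINT x:cell \<delta>x i|lebesgue. LINT l:{of_int i * \<delta>x..x}|lebesgue.
          \<rho>0 x * \<phi>x 0 l)
     - (\<Sum>\<^sub>\<infinity>k::nat. \<Sum>\<^sub>\<infinity>i::int.
          LINT t:cell \<delta>t (int k)|lebesgue. LINT x:cell \<delta>x i|lebesgue.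
            ((LINT s:{of_int i * \<delta>x..x}|lebesgue. \<phi>tx t s)
             + (LINT \<tau>:{of_nat k * \<delta>t..t}|lebesgue. \<phi>tt \<tau> (of_int i * \<delta>x))) * \<rho>\<delta> t x)
     - (\<Sum>\<^sub>\<infinity>k::nat. \<Sum>\<^sub>\<infinity>i::int.
          LINT t:cell \<delta>t (int k)|lebesgue. LINT x:cell \<delta>x (i - 1)|lebesgue.
            ((LINT s:{of_int (i - 1) * \<delta>x..x}|lebesgue. \<phi>xx t s)
             + (LINT \<tau>:{of_nat k * \<delta>t..t}|lebesgue. \<phi>xt \<tau> (of_int (i - 1) * \<delta>x)))
            * \<rho>\<delta> t x * w\<delta> t x)
     - (\<Sum>\<^sub>\<infinity>k::nat. \<Sum>\<^sub>\<infinity>i::int.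
          LINT t:cell \<delta>t (int k + 1)|lebesgue. LINT x:cell \<delta>x i|lebesgue.
            (LINT \<tau>:cell \<delta>t (int k)|lebesgue. \<phi>tt \<tau> (of_int i * \<delta>x)) * \<rho>\<delta> t x))"

definition P2 ::
  "(real \<Rightarrow> real) \<Rightarrow> (real \<Rightarrow> real) \<Rightarrow> (real \<Rightarrow> real) \<Rightarrow> real \<Rightarrow> real \<Rightarrow> (real \<Rightarrow> real)
     \<Rightarrow> (real \<Rightarrow> real \<Rightarrow> real) \<Rightarrow> real"
where
  "P2 \<kappa> h \<beta> \<delta>x \<delta>t \<rho>0 \<phi> =
    (let r = \<rho>_seq \<kappa> h \<delta>x \<delta>t \<rho>0;
         \<rho>\<delta> = \<rho>_grid \<kappa> h \<delta>x \<delta>t \<rho>0; w\<delta> = w_grid \<kappa> h \<delta>x \<delta>t \<rho>0;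
         \<phi>t = D_t \<phi>; \<phi>x = D_x \<phi>; \<phi>xt = D_t (D_x \<phi>); \<phi>xx = D_x (D_x \<phi>)
     in
     - (\<Sum>\<^sub>\<infinity>k::nat. \<Sum>\<^sub>\<infinity>i::int.
          LINT t:cell \<delta>t (int k)|lebesgue. LINT x:cell \<delta>x i|lebesgue.
            (LINT s:{of_int i * \<delta>x..x}|lebesgue. \<phi>xx t s) * Q' \<kappa> (\<rho>\<delta> t x))
     + (\<Sum>\<^sub>\<infinity>k::nat. \<Sum>\<^sub>\<infinity>i::int.
          LINT t:cell \<delta>t (int k)|lebesgue. LINT x:cell \<delta>x i|lebesgue.
            ((LINT \<tau>:{of_nat k * \<delta>t..t}|lebesgue. \<phi>t \<tau> (of_int i * \<delta>x))
             + (LINT \<xi>:{of_int i * \<delta>x..x}|lebesgue. \<phi>x t \<xi>)) * \<beta> (w\<delta> t x))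
     - (\<Sum>\<^sub>\<infinity>k::nat. \<Sum>\<^sub>\<infinity>i::int.
          LINT t:cell \<delta>t (int k)|lebesgue. LINT x:cell \<delta>x (i + 1)|lebesgue.
            ((LINT s:cell \<delta>x i|lebesgue. \<phi>xx t s)
             + (LINT \<tau>:{of_nat k * \<delta>t..t}|lebesgue. \<phi>xt \<tau> (of_int i * \<delta>x))) * Q' \<kappa> (\<rho>\<delta> t x))
     + \<delta>t * (\<Sum>\<^sub>\<infinity>k::nat. \<Sum>\<^sub>\<infinity>i::int. Q' \<kappa> (r k (i + 1)) *
          (LINT \<xi>:cell \<delta>x i|lebesgue. LINT s:{of_int i * \<delta>x..\<xi>}|lebesgue.
             \<phi>xx (of_nat k * \<delta>t) s)))"

end

theory Submission
  imports Defs
begin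

text \<open>
  The two weak equations are exact identities, and no estimate enters their proof. Against a
  test function of compact support every integral is a finite double sum over the cells of the
  grid. Testing the recursion with the nodal values \<open>\<phi>\<^sub>i\<^sup>k = \<phi>(k \<delta>t, i \<delta>x)\<close> and summing by parts
  in both indices gives (\<open>summation_by_parts_in_time\<close>)

  \<open>\<delta>t \<Sum> \<rho>\<^sub>i\<^sup>k w\<^sub>i\<^sup>k (\<phi>\<^sub>i\<^sub>+\<^sub>1\<^sup>k - \<phi>\<^sub>i\<^sup>k) + \<delta>x \<Sum> \<rho>\<^sub>i\<^sup>k\<^sup>+\<^sup>1 (\<phi>\<^sub>i\<^sup>k\<^sup>+\<^sup>1 - \<phi>\<^sub>i\<^sup>k) + \<delta>x \<Sum> \<rho>\<^sub>i\<^sup>0 \<phi>\<^sub>i\<^sup>0 = 0\<close>.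

  Each summand of the consistency error records the replacement of one nodal quantity of \<open>\<phi>\<close> by
  an integral over a cell. The fundamental theorem of calculus evaluates the inner integrals of
  second derivatives, so that the summand becomes a sum over the grid of nodal values and cell
  integrals of \<open>\<phi>\<close>, \<open>\<phi>\<^sub>t\<close>, \<open>\<phi>\<^sub>x\<close> (\<open>P1_eq\<close>, \<open>P2_eq\<close>); what remains is linear algebra. The second
  equation starts in the same way from \<open>\<delta>x \<beta>(w\<^sub>i\<^sup>k) = Q'(\<rho>\<^sub>i\<^sup>k) - Q'(\<rho>\<^sub>i\<^sub>+\<^sub>1\<^sup>k)\<close>, which is the definition
  of \<open>w\<close>. Mass is conserved because the fluxes telescope; they are summable because \<open>w\<close> is
  bounded and the nonnegative \<open>\<rho>\<^sub>i\<^sup>k\<close> are summable in \<open>i\<close>.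

  Let \<open>M = \<parallel>\<rho>\<^sub>0\<parallel>\<close>, \<open>H = \<parallel>h'\<parallel>\<close>, and let \<open>K\<close> be the maximum of \<open>\<kappa>\<close> on \<open>[0, M]\<close>. There \<open>Q'\<close> is nondecreasing
  with Lipschitz constant \<open>K\<close>, and \<open>h(s)\<close> has the sign of \<open>s\<close> with \<open>\<bar>h(s)\<bar> \<le> H \<bar>s\<bar>\<close>. Hence
  \<open>\<bar>w\<^sub>i\<^sup>k\<bar> \<le> (H K / \<delta>x) \<bar>\<rho>\<^sub>i\<^sup>k - \<rho>\<^sub>i\<^sub>+\<^sub>1\<^sup>k\<bar>\<close>, and \<open>w\<^sub>i\<^sup>k\<close> can be negative only if \<open>\<rho>\<^sub>i\<^sup>k < \<rho>\<^sub>i\<^sub>+\<^sub>1\<^sup>k\<close>. Backward flow is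
  therefore harmless although its amount \<open>\<rho>\<^sub>i\<^sup>k \<bar>w\<^sub>i\<^sup>k\<bar>\<close> is computed from the cell that it enters: it only
  leaves a denser cell, so a cell close to \<open>0\<close> loses little to its left neighbour and a cell close
  to \<open>M\<close> gains little from its right neighbour
  (\<open>step_maximum_principle\<close>).

  For the entropy, convexity of \<open>Q\<close> gives
  \<open>Q(\<rho>\<^sub>i\<^sup>k\<^sup>+\<^sup>1) \<le> Q(\<rho>\<^sub>i\<^sup>k) + Q'(\<rho>\<^sub>i\<^sup>k) D\<^sub>i + K D\<^sub>i\<^sup>2\<close> with \<open>D\<^sub>i = \<rho>\<^sub>i\<^sup>k\<^sup>+\<^sup>1 - \<rho>\<^sub>i\<^sup>k\<close>. After summation by parts the linear
  term is the dissipation \<open>- \<delta>t \<rho>\<^sub>i w\<^sub>i v\<^sub>i\<close>, where \<open>w\<^sub>i = h(v\<^sub>i)\<close>. The quadratic one is bounded by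
  \<open>4 K (\<delta>t / \<delta>x)\<^sup>2 (\<rho>\<^sub>i w\<^sub>i)\<^sup>2\<close>, and \<open>h(v)\<^sup>2 \<le> H v h(v)\<close> lets the second step size condition absorb it in the
  dissipation (\<open>discrete_entropy_inequality\<close>). At the initial time the bound is Jensen's inequality
  for the cell averages.
\<close>

section \<open>Integrals over the cells of a grid\<close>

lemma set_integral_sum:
  fixes f :: "'i \<Rightarrow> 'a \<Rightarrow> real"
  assumes "\<And>i. i \<in> I \<Longrightarrow> set_integrable M A (f i)"
  shows "set_integrable M A (\<lambda>x. \<Sum>i\<in>I. f i x)"
    and "(LINT x:A|M. \<Sum>i\<in>I. f i x) = (\<Sum>i\<in>I. LINT x:A|M. f i x)"
  using assms unfolding set_integrable_def set_lebesgue_integral_def scaleR_sum_right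
  by (intro Bochner_Integration.integrable_sum Bochner_Integration.integral_sum, blast)+

text \<open>The closed cells of the error terms overlap in their end points, where a grid function
  already takes its next value. The half-open cells partition the line.\<close>
definition halfcell :: "real \<Rightarrow> int \<Rightarrow> real set" where
  "halfcell d i = {of_int i * d..<of_int (i + 1) * d}"

lemma mem_halfcell_iff: "d > 0 \<Longrightarrow> x \<in> halfcell d i \<longleftrightarrow> \<lfloor>x / d\<rfloor> = i"
  by (auto simp: halfcell_def floor_eq_iff field_simps)

lemma halfcell_sets [measurable]: "halfcell d i \<in> sets lebesgue"
  by (simp add: halfcell_def)

lemma cell_sets [measurable]: "cell d i \<in> sets lebesgue"
  by (simp add: cell_def)

lemma cell_eq_insert: "d > 0 \<Longrightarrow> cell d i = insert (of_int (i + 1) * d) (halfcell d i)"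
  by (auto simp: cell_def halfcell_def)

lemma halfcell_subset_cell: "halfcell d i \<subseteq> cell d i"
  by (auto simp: cell_def halfcell_def)

text \<open>Splitting off the end point as a separate summand, rather than arguing almost everywhere,
  makes this hold for arbitrary integrands, measurable or not.\<close>
lemma set_integral_cell_eq_halfcell:
  fixes f :: "real \<Rightarrow> real"
  assumes "d > 0"
  shows "set_integrable lebesgue (cell d i) f \<longleftrightarrow> set_integrable lebesgue (halfcell d i) f"
    and "(LINT x:cell d i|lebesgue. f x) = (LINT x:halfcell d i|lebesgue. f x)"
proof -
  define b where "b = of_int (i + 1) * d"
  have b: "has_bochner_integral lebesgue (\<lambda>x. indicat_real {b} x * f b) 0"
    using has_bochner_integral_mult_left[OF has_bochner_integral_real_indicator[of "{b}" lebesgue], of "f b"]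
    by auto
  have eq: "(\<lambda>x. indicat_real (cell d i) x *\<^sub>R f x) =
      (\<lambda>x. indicat_real (halfcell d i) x *\<^sub>R f x + indicat_real {b} x * f b)"
    using assms by (auto simp: fun_eq_iff cell_eq_insert b_def halfcell_def indicator_def)
  have eq2: "(\<lambda>x. indicat_real (halfcell d i) x *\<^sub>R f x) =
      (\<lambda>x. indicat_real (cell d i) x *\<^sub>R f x - indicat_real {b} x * f b)"
    using eq by (simp add: fun_eq_iff)
  show iff: "set_integrable lebesgue (cell d i) f \<longleftrightarrow> set_integrable lebesgue (halfcell d i) f"
  proof
    assume "set_integrable lebesgue (cell d i) f"
    then show "set_integrable lebesgue (halfcell d i) f"
      unfolding set_integrable_def eq2 using b
      by (auto simp: has_bochner_integral_iff intro!: Bochner_Integration.integrable_diff)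
  next
    assume "set_integrable lebesgue (halfcell d i) f"
    then show "set_integrable lebesgue (cell d i) f"
      unfolding set_integrable_def eq using b
      by (auto simp: has_bochner_integral_iff intro!: Bochner_Integration.integrable_add)
  qed
  show "(LINT x:cell d i|lebesgue. f x) = (LINT x:halfcell d i|lebesgue. f x)"
  proof (cases "set_integrable lebesgue (halfcell d i) f")
    case True
    then show ?thesis
      unfolding set_lebesgue_integral_def set_integrable_def eq using b
      by (subst Bochner_Integration.integral_add) (auto simp: has_bochner_integral_iff)
  next
    case False
    with iff have "\<not> set_integrable lebesgue (cell d i) f" by simp
    with False show ?thesis
      by (simp add: set_lebesgue_integral_def set_integrable_def not_integrable_integral_eq)
  qed
qed

lemma set_integral_cell_cong:
  fixes f g :: "real \<Rightarrow> real"
  assumes "d > 0" "\<And>x. x \<in> halfcell d i \<Longrightarrow> f x = g x"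
  shows "(LINT x:cell d i|lebesgue. f x) = (LINT x:cell d i|lebesgue. g x)"
  unfolding set_integral_cell_eq_halfcell(2)[OF assms(1)]
  using assms by (intro set_lebesgue_integral_cong) auto

lemma sum_indicator_halfcell:
  fixes f :: "real \<Rightarrow> real"
  assumes "d > 0" "finite I"
  shows "(\<Sum>i\<in>I. indicat_real (halfcell d i) x *\<^sub>R f x) = (if \<lfloor>x / d\<rfloor> \<in> I then f x else 0)"
proof -
  have "(\<Sum>i\<in>I. indicat_real (halfcell d i) x *\<^sub>R f x) = (\<Sum>i\<in>I. if i = \<lfloor>x / d\<rfloor> then f x else 0)"
    using assms by (intro sum.cong) (auto simp: mem_halfcell_iff indicator_def)
  then show ?thesis using assms by simp
qed

text \<open>This reduces the integral of a function vanishing outside finitely many cells, such as a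
  test function times a grid function, to integrals over single cells.\<close>
lemma integral_finite_cells:
  fixes f :: "real \<Rightarrow> real"
  assumes "d > 0" "finite I"
    and int: "\<And>i. i \<in> I \<Longrightarrow> set_integrable lebesgue (cell d i) f"
    and zero: "\<And>x. \<lfloor>x / d\<rfloor> \<notin> I \<Longrightarrow> f x = 0"
  shows "integrable lebesgue f" "(LINT x|lebesgue. f x) = (\<Sum>i\<in>I. LINT x:cell d i|lebesgue. f x)"
proof -
  have f: "f = (\<lambda>x. \<Sum>i\<in>I. indicat_real (halfcell d i) x *\<^sub>R f x)"
    using assms(1,2) zero by (auto simp only: sum_indicator_halfcell fun_eq_iff split: if_splits)
  have int': "integrable lebesgue (\<lambda>x. indicat_real (halfcell d i) x *\<^sub>R f x)" if "i \<in> I" for i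
    using int[OF that] set_integral_cell_eq_halfcell(1)[OF assms(1)] by (simp add: set_integrable_def)
  have "integrable lebesgue (\<lambda>x. \<Sum>i\<in>I. indicat_real (halfcell d i) x *\<^sub>R f x)"
    by (intro Bochner_Integration.integrable_sum int')
  then show "integrable lebesgue f" by (simp only: f[symmetric])
  have "(LINT x|lebesgue. f x) = (LINT x|lebesgue. (\<Sum>i\<in>I. indicat_real (halfcell d i) x *\<^sub>R f x))"
    using f by metis
  also have "\<dots> = (\<Sum>i\<in>I. LINT x|lebesgue. indicat_real (halfcell d i) x *\<^sub>R f x)"
    by (intro Bochner_Integration.integral_sum int')
  finally show "(LINT x|lebesgue. f x) = (\<Sum>i\<in>I. LINT x:cell d i|lebesgue. f x)"
    using set_integral_cell_eq_halfcell(2)[OF assms(1)] by (simp add: set_lebesgue_integral_def)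
qed

lemma set_integral_nonneg_real:
  fixes f :: "'a \<Rightarrow> real"
  assumes "\<And>x. x \<in> A \<Longrightarrow> f x \<ge> 0"
  shows "(LINT x:A|M. f x) \<ge> 0"
  unfolding set_lebesgue_integral_def
  by (rule Bochner_Integration.integral_nonneg) (use assms in \<open>auto simp: indicator_def\<close>)

lemma set_integrable_cell:
  assumes "integrable lebesgue (f :: real \<Rightarrow> real)"
  shows "set_integrable lebesgue (cell d i) f"
  using integrable_mult_indicator[OF cell_sets assms] by (simp add: set_integrable_def)

text \<open>For integrands without compact support, such as the density itself. Finite partial sums are
  bounded by the total integral, which makes the series converge unconditionally; its value
  comes from countable additivity along an enumeration of the integers.\<close>
lemma has_sum_integral_cells:
  fixes f :: "real \<Rightarrow> real"
  assumes "d > 0" and f: "integrable lebesgue f" and nn: "\<And>x. f x \<ge> 0"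
  shows "((\<lambda>i. LINT x:cell d i|lebesgue. f x) has_sum (LINT x|lebesgue. f x)) UNIV"
proof -
  let ?u = "\<lambda>i. LINT x:cell d i|lebesgue. f x"
  have nnu: "?u i \<ge> 0" for i by (rule set_integral_nonneg_real) (rule nn)
  have int': "integrable lebesgue (\<lambda>x. indicat_real (halfcell d i) x *\<^sub>R f x)" for i
    by (rule integrable_mult_indicator[OF halfcell_sets f])
  have bd: "sum ?u F \<le> (LINT x|lebesgue. f x)" if "finite F" for F
  proof -
    have "sum ?u F = (LINT x|lebesgue. (\<Sum>i\<in>F. indicat_real (halfcell d i) x *\<^sub>R f x))"
      using set_integral_cell_eq_halfcell(2)[OF assms(1)] int'
      by (subst Bochner_Integration.integral_sum) (auto simp: set_lebesgue_integral_def)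
    also have "\<dots> \<le> (LINT x|lebesgue. f x)"
      using nn by (intro integral_mono f Bochner_Integration.integrable_sum int')
        (simp del: real_scaleR_def add: sum_indicator_halfcell[OF assms(1) that])
    finally show ?thesis .
  qed
  have summ: "?u summable_on UNIV"
    by (rule nonneg_bdd_above_summable_on) (use nnu bd in \<open>auto intro!: bdd_aboveI2\<close>)
  have bij: "bij_betw int_decode UNIV UNIV" by (rule bij_int_decode)
  have summ': "(\<lambda>n. ?u (int_decode n)) summable_on UNIV"
    using summable_on_reindex_bij_betw[OF bij, of ?u] summ by simp
  have U: "(\<Union>n. halfcell d (int_decode n)) = UNIV"
    using surj_int_decode assms(1) by (auto simp: mem_halfcell_iff) (metis surjD)
  have "(LINT x|lebesgue. f x) = (LINT x:(\<Union>n. halfcell d (int_decode n))|lebesgue. f x)"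
    by (simp add: U set_lebesgue_integral_def)
  also have "\<dots> = (\<Sum>n. LINT x:halfcell d (int_decode n)|lebesgue. f x)"
    by (rule lebesgue_integral_countable_add)
      (use assms(1) f in \<open>auto simp: mem_halfcell_iff set_integrable_def U int_decode_eq\<close>)
  also have "\<dots> = (\<Sum>n. ?u (int_decode n))"
    by (simp add: set_integral_cell_eq_halfcell(2)[OF assms(1)])
  also have "\<dots> = (\<Sum>\<^sub>\<infinity>n. ?u (int_decode n))"
    using has_sum_imp_sums[OF has_sum_infsum[OF summ']] by (simp add: sums_iff)
  also have "\<dots> = infsum ?u UNIV" by (rule infsum_reindex_bij_betw[OF bij])
  finally show ?thesis using summ by (simp add: has_sum_infsum)
qed

lemma integral_const_cell:
  assumes "d > 0"
  shows "set_integrable lebesgue (cell d i) (\<lambda>_. c :: real)" "(LINT x:cell d i|lebesgue. c) = d * c"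
proof -
  show "set_integrable lebesgue (cell d i) (\<lambda>_. c :: real)"
    unfolding cell_def by (intro absolutely_integrable_continuous_real continuous_intros)
  then show "(LINT x:cell d i|lebesgue. c) = d * c"
    using assms by (simp add: set_lebesgue_integral_eq_integral cell_def algebra_simps)
qed

text \<open>Converse direction: a summable nonnegative family defines an integrable step function.\<close>
lemma integral_step_function:
  fixes u :: "int \<Rightarrow> real"
  assumes "d > 0" and u: "u summable_on UNIV" and nn: "\<And>i. u i \<ge> 0"
  shows "integrable lebesgue (\<lambda>x. u \<lfloor>x / d\<rfloor>)" "(LINT x|lebesgue. u \<lfloor>x / d\<rfloor>) = d * infsum u UNIV"
proof -
  define g where "g n x = indicat_real (halfcell d (int_decode n)) x * u (int_decode n)" for n x
  have g0: "g n x = 0" if "n \<noteq> int_encode \<lfloor>x / d\<rfloor>" for n x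
    using that assms(1) by (auto simp: g_def indicator_def mem_halfcell_iff)
  have gs: "(\<lambda>n. g n x) sums u \<lfloor>x / d\<rfloor>" for x
  proof -
    have "(\<lambda>n. g n x) sums (\<Sum>n\<in>{int_encode \<lfloor>x / d\<rfloor>}. g n x)"
      by (rule sums_finite) (use g0 in auto)
    then show ?thesis using assms(1) by (simp add: g_def mem_halfcell_iff)
  qed
  have hc: "has_bochner_integral lebesgue (g n) (d * u (int_decode n))" for n
  proof -
    have "set_integrable lebesgue (halfcell d (int_decode n)) (\<lambda>_. u (int_decode n))"
         "(LINT x:halfcell d (int_decode n)|lebesgue. u (int_decode n)) = d * u (int_decode n)"
      using integral_const_cell[OF assms(1)] set_integral_cell_eq_halfcell[OF assms(1)] by metis+
    then show ?thesis
      by (simp add: has_bochner_integral_iff set_integrable_def set_lebesgue_integral_def g_def[abs_def])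
  qed
  have su: "(\<lambda>n. u (int_decode n)) summable_on UNIV"
    using summable_on_reindex_bij_betw[OF bij_int_decode, of u] u by simp
  have "integrable lebesgue (\<lambda>x. \<Sum>n. g n x)"
  proof (rule integrable_suminf)
    show "integrable lebesgue (g n)" for n using hc[of n] by (simp add: has_bochner_integral_iff)
    show "AE x in lebesgue. summable (\<lambda>n. norm (g n x))"
      by (intro AE_I2 summable_finite[of "{int_encode \<lfloor>_ / d\<rfloor>}"]) (use g0 in auto)
    have "norm (g n x) = g n x" for n x using nn by (simp add: g_def)
    then have "(\<lambda>n. LINT x|lebesgue. norm (g n x)) = (\<lambda>n. d * u (int_decode n))"
      using hc by (simp add: has_bochner_integral_iff)
    moreover have "summable (\<lambda>n. u (int_decode n))"
      using has_sum_imp_sums[OF has_sum_infsum[OF su]] by (simp add: sums_iff)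
    ultimately show "summable (\<lambda>n. LINT x|lebesgue. norm (g n x))" by simp
  qed
  then show int: "integrable lebesgue (\<lambda>x. u \<lfloor>x / d\<rfloor>)"
    using gs by (simp add: sums_iff)
  have "(LINT x:cell d i|lebesgue. u \<lfloor>x / d\<rfloor>) = d * u i" for i
    using set_integral_cell_cong[OF assms(1), of i "\<lambda>x. u \<lfloor>x / d\<rfloor>" "\<lambda>_. u i"] assms(1)
    by (simp add: mem_halfcell_iff integral_const_cell)
  then have "((\<lambda>i. d * u i) has_sum (LINT x|lebesgue. u \<lfloor>x / d\<rfloor>)) UNIV"
    using has_sum_integral_cells[OF assms(1) int nn] by simp
  then show "(LINT x|lebesgue. u \<lfloor>x / d\<rfloor>) = d * infsum u UNIV"
    by (simp add: infsumI infsum_cmult_right'[symmetric])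
qed

section \<open>Double sums over the space-time grid\<close>

text \<open>The shape in which the error terms are written: an infinite sum over time levels of infinite
  sums over cells.\<close>
definition grid_sum :: "(nat \<Rightarrow> int \<Rightarrow> real) \<Rightarrow> real" where
  "grid_sum f = (\<Sum>\<^sub>\<infinity>k. \<Sum>\<^sub>\<infinity>i. f k i)"

definition fin_supp :: "(nat \<Rightarrow> int \<Rightarrow> real) \<Rightarrow> bool" where
  "fin_supp f \<longleftrightarrow> (\<exists>N. \<forall>k i. k \<ge> N \<or> \<bar>i\<bar> \<ge> int N \<longrightarrow> f k i = 0)"

lemma fin_suppI: "(\<And>k i. k \<ge> N \<or> \<bar>i\<bar> \<ge> int N \<Longrightarrow> f k i = 0) \<Longrightarrow> fin_supp f"
  by (auto simp: fin_supp_def)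

lemma fin_supp_add:
  assumes "fin_supp f" "fin_supp g" shows "fin_supp (\<lambda>k i. f k i + g k i)"
proof -
  obtain M N where "\<And>k i. k \<ge> M \<or> \<bar>i\<bar> \<ge> int M \<Longrightarrow> f k i = 0" "\<And>k i. k \<ge> N \<or> \<bar>i\<bar> \<ge> int N \<Longrightarrow> g k i = 0"
    using assms unfolding fin_supp_def by metis
  then show ?thesis by (intro fin_suppI[of "max M N"]) (auto simp: of_nat_max)
qed

lemma fin_supp_mult_left: "fin_supp f \<Longrightarrow> fin_supp (\<lambda>k i. c k i * f k i)"
  by (auto simp: fin_supp_def)

lemma fin_supp_mult_right: "fin_supp f \<Longrightarrow> fin_supp (\<lambda>k i. f k i * c k i)"
  by (auto simp: fin_supp_def)

lemma fin_supp_diff: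
  assumes "fin_supp f" "fin_supp g" shows "fin_supp (\<lambda>k i. f k i - g k i)"
  using fin_supp_add[OF assms(1) fin_supp_mult_left[OF assms(2), of "\<lambda>_ _. -1"]] by simp

lemma fin_supp_shift:
  assumes "fin_supp f" "\<bar>j\<bar> \<le> 1" shows "fin_supp (\<lambda>k i. f (k + n) (i + j))"
proof -
  obtain M where "\<And>k i. k \<ge> M \<or> \<bar>i\<bar> \<ge> int M \<Longrightarrow> f k i = 0"
    using assms unfolding fin_supp_def by metis
  moreover have "k + n \<ge> M \<or> \<bar>i + j\<bar> \<ge> int M" if "k \<ge> Suc M \<or> \<bar>i\<bar> \<ge> int (Suc M)" for k i
    using assms(2) that by linarith
  ultimately show ?thesis by (intro fin_suppI[of "Suc M"]) blast
qed

lemma fin_supp_shifts: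
  assumes "fin_supp f"
  shows "fin_supp (\<lambda>k i. f k (i + 1))" "fin_supp (\<lambda>k i. f k (i - 1))" "fin_supp (\<lambda>k i. f (k + 1) i)"
  using fin_supp_shift[OF assms, of 1 0] fin_supp_shift[OF assms, of "-1" 0]
    fin_supp_shift[OF assms, of 0 1] by auto

lemma fin_supp_summable:
  assumes "fin_supp f"
  shows "f k summable_on UNIV" "(\<lambda>k. \<Sum>\<^sub>\<infinity>i. f k i) summable_on UNIV"
proof -
  obtain M where M: "\<And>k i. k \<ge> M \<or> \<bar>i\<bar> \<ge> int M \<Longrightarrow> f k i = 0"
    using assms unfolding fin_supp_def by metis
  have "{i. f k i \<noteq> 0} \<subseteq> {- int M..int M}"
  proof
    fix i assume "i \<in> {i. f k i \<noteq> 0}"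
    then have "\<not> \<bar>i\<bar> \<ge> int M" using M by blast
    then show "i \<in> {- int M..int M}" by auto
  qed
  then show "f k summable_on UNIV"
    by (intro finite_nonzero_values_imp_summable_on) (simp add: finite_subset)
  have "(\<Sum>\<^sub>\<infinity>i. f k i) = 0" if "k \<ge> M" for k using M that by simp
  then have "{k. (\<Sum>\<^sub>\<infinity>i. f k i) \<noteq> 0} \<subseteq> {..<M}" by (auto simp: not_le[symmetric])
  then show "(\<lambda>k. \<Sum>\<^sub>\<infinity>i. f k i) summable_on UNIV"
    by (intro finite_nonzero_values_imp_summable_on) (simp add: finite_subset)
qed

lemma grid_sum_add: "fin_supp f \<Longrightarrow> fin_supp g \<Longrightarrow> grid_sum (\<lambda>k i. f k i + g k i) = grid_sum f + grid_sum g"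
  by (simp add: grid_sum_def infsum_add fin_supp_summable)

lemma grid_sum_cmult: "grid_sum (\<lambda>k i. c * f k i) = c * grid_sum f"
  by (simp add: grid_sum_def infsum_cmult_right')

lemma grid_sum_diff: "fin_supp f \<Longrightarrow> fin_supp g \<Longrightarrow> grid_sum (\<lambda>k i. f k i - g k i) = grid_sum f - grid_sum g"
  using grid_sum_add[of f "\<lambda>k i. -1 * g k i"] grid_sum_cmult[of "-1" g]
    fin_supp_mult_left[of g "\<lambda>_ _. -1"] by simp

lemma infsum_int_shift: "(\<Sum>\<^sub>\<infinity>i::int. f (i + j)) = (\<Sum>\<^sub>\<infinity>i. f i :: real)"
  by (rule infsum_reindex_bij_witness[of _ "\<lambda>i. i - j" "\<lambda>i. i + j"]) auto

lemma grid_sum_shift_space: "grid_sum (\<lambda>k i. f k (i - 1)) = grid_sum f" "grid_sum (\<lambda>k i. f k (i + 1)) = grid_sum f"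
  using infsum_int_shift[of "f _" "-1"] infsum_int_shift[of "f _" 1] by (simp_all add: grid_sum_def)

text \<open>The time index starts at \<open>0\<close>, so shifting it leaves the initial level behind. This is the
  source of all initial terms in the weak equations.\<close>
lemma grid_sum_shift_time:
  assumes "fin_supp f"
  shows "grid_sum f = (\<Sum>\<^sub>\<infinity>i. f 0 i) + grid_sum (\<lambda>k i. f (k + 1) i)"
proof -
  let ?F = "\<lambda>k. \<Sum>\<^sub>\<infinity>i. f k i"
  have s: "?F summable_on range Suc"
    by (rule summable_on_subset_banach[OF fin_supp_summable(2)[OF assms]]) simp
  have "grid_sum f = infsum ?F (insert 0 (range Suc))"
    by (simp add: grid_sum_def UNIV_nat_eq[symmetric])
  also have "\<dots> = ?F 0 + infsum ?F (range Suc)"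
    by (rule infsum_insert[OF s]) simp
  also have "infsum ?F (range Suc) = grid_sum (\<lambda>k i. f (k + 1) i)"
    by (subst infsum_reindex) (simp_all add: grid_sum_def o_def)
  finally show ?thesis .
qed

lemma grid_sum_eq_sum:
  assumes "\<And>k i. k \<ge> N \<or> \<bar>i\<bar> \<ge> int N \<Longrightarrow> f k i = 0"
  shows "grid_sum f = (\<Sum>k<N. \<Sum>i\<in>{-int N..<int N}. f k i)"
proof -
  have "(\<Sum>\<^sub>\<infinity>i. f k i) = (\<Sum>i\<in>{-int N..<int N}. f k i)" for k
    by (subst infsum_finite[symmetric], simp, rule infsum_cong_neutral) (use assms in auto)
  moreover have "(\<Sum>\<^sub>\<infinity>k. \<Sum>i\<in>{-int N..<int N}. f k i) = (\<Sum>k<N. \<Sum>i\<in>{-int N..<int N}. f k i)"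
    by (subst infsum_finite[symmetric], simp, rule infsum_cong_neutral) (use assms in auto)
  ultimately show ?thesis by (simp add: grid_sum_def)
qed

section \<open>Calculus on the closed half plane\<close>

lemma cont_halfplane_slices:
  assumes "cont_halfplane \<psi>"
  shows "t \<ge> 0 \<Longrightarrow> continuous_on S (\<psi> t)" "S \<subseteq> {0..} \<Longrightarrow> continuous_on S (\<lambda>t. \<psi> t x)"
proof -
  have c: "continuous_on ({0..} \<times> UNIV) (\<lambda>(t, x). \<psi> t x)"
    using assms by (simp add: cont_halfplane_def)
  show "continuous_on S (\<psi> t)" if "t \<ge> 0"
    using continuous_on_compose2[OF c continuous_on_Pair[OF continuous_on_const continuous_on_id], of t] that by auto
  show "continuous_on S (\<lambda>t. \<psi> t x)" if "S \<subseteq> {0..}"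
    using continuous_on_compose2[OF c continuous_on_Pair[OF continuous_on_id continuous_on_const], of x] that by auto
qed

lemma set_integral_interval:
  fixes f :: "real \<Rightarrow> real"
  assumes "continuous_on {a..b} f"
  shows "set_integrable lebesgue {a..b} f" "(LINT x:{a..b}|lebesgue. f x) = integral {a..b} f"
  using absolutely_integrable_continuous_real[OF assms] by (simp_all add: set_lebesgue_integral_eq_integral)

lemma C1_halfplane_cont:
  assumes "C1_halfplane \<psi>"
  shows "cont_halfplane \<psi>" "cont_halfplane (D_t \<psi>)" "cont_halfplane (D_x \<psi>)"
  using assms by (simp_all add: C1_halfplane_def)

lemma C2_halfplane_C1:
  assumes "C2_halfplane \<phi>"
  shows "C1_halfplane \<phi>" "C1_halfplane (D_t \<phi>)" "C1_halfplane (D_x \<phi>)"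
  using assms by (simp_all add: C2_halfplane_def)

lemma FTC_space:
  assumes "C1_halfplane \<psi>" "t \<ge> 0" "a \<le> b"
  shows "(LINT s:{a..b}|lebesgue. D_x \<psi> t s) = \<psi> t b - \<psi> t a"
proof -
  have c: "continuous_on {a..b} (D_x \<psi> t)"
    using assms by (intro cont_halfplane_slices) (auto simp: C1_halfplane_def)
  have "(\<psi> t has_vector_derivative D_x \<psi> t x) (at x within {a..b})" for x
  proof -
    have "\<psi> t differentiable (at x)" using assms by (auto simp: C1_halfplane_def)
    then show ?thesis
      unfolding D_x_def vector_derivative_works by (rule has_vector_derivative_at_within)
  qed
  then have "(D_x \<psi> t has_integral \<psi> t b - \<psi> t a) {a..b}"
    by (intro fundamental_theorem_of_calculus assms)
  then show ?thesis using set_integral_interval(2)[OF c] by (simp only: integral_unique)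
qed

lemma FTC_time:
  assumes "C1_halfplane \<psi>" "0 \<le> a" "a \<le> b"
  shows "(LINT \<tau>:{a..b}|lebesgue. D_t \<psi> \<tau> x) = \<psi> b x - \<psi> a x"
proof -
  have c: "continuous_on {a..b} (\<lambda>\<tau>. D_t \<psi> \<tau> x)"
    using assms by (intro cont_halfplane_slices) (auto simp: C1_halfplane_def)
  have "((\<lambda>\<tau>. \<psi> \<tau> x) has_vector_derivative D_t \<psi> t x) (at t within {a..b})" if "t \<in> {a..b}" for t
  proof -
    have "(\<lambda>\<tau>. \<psi> \<tau> x) differentiable (at t within {0..})"
      using assms that by (auto simp: C1_halfplane_def)
    then show ?thesis
      unfolding D_t_def vector_derivative_works
      by (rule has_vector_derivative_within_subset) (use assms in auto)
  qed
  then have "((\<lambda>\<tau>. D_t \<psi> \<tau> x) has_integral \<psi> b x - \<psi> a x) {a..b}"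
    by (intro fundamental_theorem_of_calculus assms)
  then show ?thesis using set_integral_interval(2)[OF c] by (simp only: integral_unique)
qed

text \<open>The double integrals of second derivatives are integral remainders of first order Taylor
  expansions around the left end point.\<close>
lemma Taylor_space:
  assumes "C2_halfplane \<phi>" "t \<ge> 0" "a \<le> b"
  shows "(LINT \<xi>:{a..b}|lebesgue. LINT s:{a..\<xi>}|lebesgue. D_x (D_x \<phi>) t s)
       = \<phi> t b - \<phi> t a - (b - a) * D_x \<phi> t a"
proof -
  note C1 = C2_halfplane_C1(1)[OF assms(1)] C2_halfplane_C1(3)[OF assms(1)]
  have c: "continuous_on {a..b} (D_x \<phi> t)"
    by (rule cont_halfplane_slices[OF C1_halfplane_cont(1)[OF C1(2)]]) (use assms(2) in auto)
  have "(LINT \<xi>:{a..b}|lebesgue. LINT s:{a..\<xi>}|lebesgue. D_x (D_x \<phi>) t s)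
      = (LINT \<xi>:{a..b}|lebesgue. D_x \<phi> t \<xi> - D_x \<phi> t a)"
    by (intro set_lebesgue_integral_cong allI impI FTC_space[OF C1(2)]) (use assms(2) in auto)
  also have "\<dots> = (LINT \<xi>:{a..b}|lebesgue. D_x \<phi> t \<xi>) - (LINT \<xi>:{a..b}|lebesgue. D_x \<phi> t a)"
    by (rule set_integral_diff(2)[OF set_integral_interval(1)[OF c] set_integral_interval(1)[OF continuous_on_const]])
  also have "(LINT \<xi>:{a..b}|lebesgue. D_x \<phi> t a) = (b - a) * D_x \<phi> t a"
    using assms(3) by (simp add: set_integral_interval(2)[OF continuous_on_const])
  finally show ?thesis by (simp only: FTC_space[OF C1(1) assms(2,3)])
qed

lemma Taylor_time:
  assumes "C2_halfplane \<phi>" "0 \<le> a" "a \<le> b"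
  shows "(LINT \<tau>:{a..b}|lebesgue. LINT l:{a..\<tau>}|lebesgue. D_t (D_t \<phi>) l x)
       = \<phi> b x - \<phi> a x - (b - a) * D_t \<phi> a x"
proof -
  note C1 = C2_halfplane_C1(1)[OF assms(1)] C2_halfplane_C1(2)[OF assms(1)]
  have c: "continuous_on {a..b} (\<lambda>t. D_t \<phi> t x)"
    by (rule cont_halfplane_slices[OF C1_halfplane_cont(1)[OF C1(2)]]) (use assms(2) in auto)
  have "(LINT \<tau>:{a..b}|lebesgue. LINT l:{a..\<tau>}|lebesgue. D_t (D_t \<phi>) l x)
      = (LINT \<tau>:{a..b}|lebesgue. D_t \<phi> \<tau> x - D_t \<phi> a x)"
    by (intro set_lebesgue_integral_cong allI impI FTC_time[OF C1(2)]) (use assms(2) in auto)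
  also have "\<dots> = (LINT \<tau>:{a..b}|lebesgue. D_t \<phi> \<tau> x) - (LINT \<tau>:{a..b}|lebesgue. D_t \<phi> a x)"
    by (rule set_integral_diff(2)[OF set_integral_interval(1)[OF c] set_integral_interval(1)[OF continuous_on_const]])
  also have "(LINT \<tau>:{a..b}|lebesgue. D_t \<phi> a x) = (b - a) * D_t \<phi> a x"
    using assms(3) by (simp add: set_integral_interval(2)[OF continuous_on_const])
  finally show ?thesis by (simp only: FTC_time[OF C1(1) assms(2,3)])
qed

section \<open>Integrals over space-time cells\<close>

definition cell_integral :: "real \<Rightarrow> real \<Rightarrow> (real \<Rightarrow> real \<Rightarrow> real) \<Rightarrow> nat \<Rightarrow> int \<Rightarrow> real" where
  "cell_integral d e \<psi> k i = (LINT t:cell e (int k)|lebesgue. LINT x:cell d i|lebesgue. \<psi> t x)"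

lemma cell_nonneg:
  assumes "e > 0" "t \<in> cell e (int k)"
  shows "t \<ge> 0"
proof -
  have "0 \<le> real k * e" using assms(1) by simp
  also have "\<dots> \<le> t" using assms(2) by (simp add: cell_def)
  finally show ?thesis .
qed

lemma node_mem_cell: "d > 0 \<Longrightarrow> of_int i * d \<in> cell d i"
  by (simp add: cell_def algebra_simps)

lemma halfcell_nonneg: "e > 0 \<Longrightarrow> t \<in> halfcell e (int k) \<Longrightarrow> t \<ge> 0"
  using cell_nonneg halfcell_subset_cell by blast

lemma cell_integral_cong:
  assumes "d > 0" "e > 0"
    and "\<And>t x. t \<in> halfcell e (int k) \<Longrightarrow> x \<in> halfcell d i \<Longrightarrow> f t x = g t x"
  shows "cell_integral d e f k i = cell_integral d e g k i"
  unfolding cell_integral_def using assms by (intro set_integral_cell_cong) auto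

lemma cell_integral_mult_right: "cell_integral d e (\<lambda>t x. f t x * c) k i = cell_integral d e f k i * c"
  by (simp add: cell_integral_def)

lemma cont_cell_integral:
  assumes "cont_halfplane \<psi>" "S \<subseteq> {0..}" "d > 0"
  shows "continuous_on S (\<lambda>t. LINT x:cell d i|lebesgue. \<psi> t x)"
proof -
  let ?a = "of_int i * d" and ?b = "of_int (i + 1) * d"
  have c: "continuous_on (S \<times> cbox ?a ?b) (\<lambda>(t, x). \<psi> t x)"
    by (rule continuous_on_subset[OF assms(1)[unfolded cont_halfplane_def]]) (use assms(2) in auto)
  have "continuous_on S (\<lambda>t. integral (cbox ?a ?b) (\<psi> t))"
    by (rule integral_continuous_on_param) (use c in simp)
  moreover have "(LINT x:cell d i|lebesgue. \<psi> t x) = integral (cbox ?a ?b) (\<psi> t)" if "t \<in> S" for t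
    unfolding cell_def cbox_interval
    by (rule set_integral_interval) (use assms that cont_halfplane_slices in blast)
  ultimately show ?thesis by (simp cong: continuous_on_cong)
qed

lemma set_integrable_cell_space:
  assumes "cont_halfplane \<psi>" "t \<ge> 0"
  shows "set_integrable lebesgue (cell d i) (\<psi> t)"
  unfolding cell_def using assms by (intro set_integral_interval cont_halfplane_slices)

lemma set_integrable_cell_time:
  assumes "cont_halfplane \<psi>" "d > 0" "e > 0"
  shows "set_integrable lebesgue (cell e (int k)) (\<lambda>t. LINT x:cell d i|lebesgue. \<psi> t x)"
  unfolding cell_def[of e]
  by (intro set_integral_interval cont_cell_integral assms)
    (use assms cell_nonneg[of e _ k] in \<open>auto simp: cell_def\<close>)

lemma cell_integral_lincomb:
  assumes "d > 0" "e > 0" "cont_halfplane f" "cont_halfplane g"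
  shows "cell_integral d e (\<lambda>t x. a * f t x + b * g t x) k i = a * cell_integral d e f k i + b * cell_integral d e g k i"
proof -
  have "cell_integral d e (\<lambda>t x. a * f t x + b * g t x) k i =
    (LINT t:cell e (int k)|lebesgue. a * (LINT x:cell d i|lebesgue. f t x) + b * (LINT x:cell d i|lebesgue. g t x))"
    unfolding cell_integral_def
    by (intro set_lebesgue_integral_cong)
      (use cell_nonneg[OF assms(2)] set_integrable_cell_space assms in \<open>auto simp: set_integral_add\<close>)
  also have "\<dots> = a * cell_integral d e f k i + b * cell_integral d e g k i"
    unfolding cell_integral_def
    by (subst set_integral_add) (use set_integrable_cell_time assms in auto)
  finally show ?thesis .
qed

lemma cell_integral_diff:
  assumes "d > 0" "e > 0" "cont_halfplane f" "cont_halfplane g"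
  shows "cell_integral d e (\<lambda>t x. f t x - g t x) k i = cell_integral d e f k i - cell_integral d e g k i"
  using cell_integral_lincomb[OF assms, of 1 "-1"] by simp

lemma cont_halfplane_trace: "cont_halfplane \<psi> \<Longrightarrow> cont_halfplane (\<lambda>t x. \<psi> t c)"
  using continuous_on_compose2[of "{0..} \<times> UNIV" "\<lambda>(t, x). \<psi> t x" "{0..} \<times> UNIV" "\<lambda>p. (fst p, c)"]
    continuous_on_Pair[OF continuous_on_fst[OF continuous_on_id] continuous_on_const, of "{0..} \<times> UNIV" c]
  unfolding cont_halfplane_def case_prod_beta by (simp add: image_subset_iff)

lemma cont_halfplane_const: "cont_halfplane (\<lambda>t x. c)"
  by (simp add: cont_halfplane_def case_prod_beta)

lemma cell_integral_const: "d > 0 \<Longrightarrow> e > 0 \<Longrightarrow> cell_integral d e (\<lambda>t x. c) k i = e * d * c"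
  by (simp add: cell_integral_def integral_const_cell)

text \<open>The bounds are multiples of the mesh sizes, so that whole cells lie outside the support.\<close>
definition vanishes_beyond :: "real \<Rightarrow> real \<Rightarrow> nat \<Rightarrow> (real \<Rightarrow> real \<Rightarrow> real) \<Rightarrow> bool" where
  "vanishes_beyond d e N \<psi> \<longleftrightarrow>
     (\<forall>t\<ge>0. \<forall>x. t \<ge> of_nat N * e \<or> \<bar>x\<bar> \<ge> of_nat N * d \<longrightarrow> \<psi> t x = 0)"

text \<open>One extra layer of cells is needed since a closed cell touches its neighbour.\<close>
lemma vanishes_beyond_cell:
  assumes "vanishes_beyond d e N \<psi>" "d > 0" "e > 0" "k \<ge> Suc N \<or> \<bar>i\<bar> \<ge> int (Suc N)"
    "t \<in> cell e (int k)" "x \<in> cell d i"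
  shows "\<psi> t x = 0"
proof -
  have t0: "t \<ge> 0" using assms cell_nonneg by blast
  have "t \<ge> of_nat N * e \<or> x \<ge> of_nat N * d \<or> x \<le> - (of_nat N * d)"
  proof -
    consider "k \<ge> N" | "i \<ge> int N" | "i + 1 \<le> - int N" using assms(4) by linarith
    then show ?thesis
    proof cases
      case 1
      then have "of_nat N * e \<le> of_nat k * e" using assms(3) by simp
      then show ?thesis using assms(5) by (auto simp: cell_def)
    next
      case 2
      then have "of_int (int N) * d \<le> of_int i * d" using assms(2) by (simp only: mult_right_mono of_int_le_iff less_imp_le)
      then show ?thesis using assms(6) by (auto simp: cell_def)
    next
      case 3
      then have "of_int (i + 1) * d \<le> of_int (- int N) * d" using assms(2) by (simp only: mult_right_mono of_int_le_iff less_imp_le)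
      then show ?thesis using assms(6) by (auto simp: cell_def)
    qed
  qed
  then have "t \<ge> of_nat N * e \<or> \<bar>x\<bar> \<ge> of_nat N * d" by linarith
  then show ?thesis using assms(1) t0 unfolding vanishes_beyond_def by blast
qed

lemma fin_supp_cell_integral:
  assumes "vanishes_beyond d e N \<psi>" "d > 0" "e > 0"
  shows "fin_supp (cell_integral d e \<psi>)"
proof (rule fin_suppI[of "Suc N"])
  fix k i assume "k \<ge> Suc N \<or> \<bar>i\<bar> \<ge> int (Suc N)"
  then have "cell_integral d e \<psi> k i = cell_integral d e (\<lambda>_ _. 0) k i"
    using vanishes_beyond_cell[OF assms] halfcell_subset_cell by (intro cell_integral_cong assms) blast
  then show "cell_integral d e \<psi> k i = 0" by (simp add: cell_integral_def)
qed

lemma fin_supp_nodes: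
  assumes "vanishes_beyond d e N \<psi>" "d > 0" "e > 0"
  shows "fin_supp (\<lambda>k i. \<psi> (of_nat k * e) (of_int i * d))"
proof (rule fin_suppI[of "Suc N"])
  fix k i assume *: "k \<ge> Suc N \<or> \<bar>i\<bar> \<ge> int (Suc N)"
  show "\<psi> (of_nat k * e) (of_int i * d) = 0"
    by (rule vanishes_beyond_cell[OF assms * node_mem_cell[of e "int k", simplified] node_mem_cell])
      (use assms in auto)
qed

text \<open>The bridge from the weak formulation to grid sums. On each half-open space-time cell the
  integrand \<open>G\<close> is a continuous function \<open>g k i\<close>, namely a test function with constant coefficients;
  globally it jumps across the grid lines. Since \<open>G\<close> vanishes far out, only finitely many cells
  contribute, first in \<open>x\<close> for fixed \<open>t\<close> and then in \<open>t\<close>.\<close>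
lemma space_time_integral_cells:
  assumes "d > 0" "e > 0"
    and c: "\<And>k i. cont_halfplane (g k i)"
    and eq: "\<And>k i t x. t \<in> halfcell e (int k) \<Longrightarrow> x \<in> halfcell d i \<Longrightarrow> G t x = g k i t x"
    and v: "vanishes_beyond d e N G"
  shows "(LINT t:{0..}|lebesgue. LINT x|lebesgue. G t x) = grid_sum (\<lambda>k i. cell_integral d e (g k i) k i)"
proof -
  let ?M = "Suc N" and ?I = "{- int (Suc N)..<int (Suc N)}"
  have fl: "t \<in> cell e \<lfloor>t / e\<rfloor>" "x \<in> cell d \<lfloor>x / d\<rfloor>" for t x
    using assms by (auto simp: mem_halfcell_iff intro!: subsetD[OF halfcell_subset_cell])
  have intx: "(LINT x|lebesgue. G t x) = (\<Sum>i\<in>?I. LINT x:cell d i|lebesgue. g k i t x)"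
    if t: "t \<in> halfcell e (int k)" for t k
  proof -
    have t0: "t \<ge> 0" using t assms(2) halfcell_nonneg by blast
    have tc: "t \<in> cell e (int k)" using t halfcell_subset_cell by blast
    have "(LINT x|lebesgue. G t x) = (\<Sum>i\<in>?I. LINT x:cell d i|lebesgue. G t x)"
    proof (rule integral_finite_cells[OF assms(1)])
      show "set_integrable lebesgue (cell d i) (G t)" for i
      proof -
        have "set_integrable lebesgue (halfcell d i) (g k i t)"
          using set_integrable_cell_space[OF c t0] set_integral_cell_eq_halfcell(1)[OF assms(1)] by blast
        also have "?this \<longleftrightarrow> set_integrable lebesgue (halfcell d i) (G t)"
          by (intro set_integrable_cong) (use eq t in auto)
        finally show ?thesis using set_integral_cell_eq_halfcell(1)[OF assms(1)] by blast
      qed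
      show "G t x = 0" if "\<lfloor>x / d\<rfloor> \<notin> ?I" for x
        by (rule vanishes_beyond_cell[OF v assms(1,2), of k "\<lfloor>x / d\<rfloor>"])
          (use that tc fl in \<open>auto simp: not_le\<close>)
    qed simp
    also have "\<dots> = (\<Sum>i\<in>?I. LINT x:cell d i|lebesgue. g k i t x)"
      by (intro sum.cong refl set_integral_cell_cong assms) (use eq t in auto)
    finally show ?thesis .
  qed
  define F where "F t = indicat_real {0..} t * (LINT x|lebesgue. G t x)" for t
  have F: "F t = (\<Sum>i\<in>?I. LINT x:cell d i|lebesgue. g k i t x)" if "t \<in> halfcell e (int k)" for t k
    using intx[OF that] halfcell_nonneg[OF assms(2) that] by (simp add: F_def)
  have ic: "set_integrable lebesgue (cell e (int k)) (\<lambda>t. \<Sum>i\<in>?I. LINT x:cell d i|lebesgue. g k i t x)" for k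
    by (rule set_integral_sum(1)) (use set_integrable_cell_time[OF c assms(1,2)] in auto)
  have "(LINT t:{0..}|lebesgue. LINT x|lebesgue. G t x) = (LINT t|lebesgue. F t)"
    by (simp add: set_lebesgue_integral_def F_def)
  also have "\<dots> = (\<Sum>k\<in>int ` {..<?M}. LINT t:cell e k|lebesgue. F t)"
  proof (rule integral_finite_cells[OF assms(2)])
    show "set_integrable lebesgue (cell e k) F" if k: "k \<in> int ` {..<?M}" for k
    proof -
      obtain n where n: "k = int n" using k by blast
      have "set_integrable lebesgue (halfcell e k) (\<lambda>t. \<Sum>i\<in>?I. LINT x:cell d i|lebesgue. g n i t x)"
        using ic[of n] set_integral_cell_eq_halfcell(1)[OF assms(2)] n by blast
      also have "?this \<longleftrightarrow> set_integrable lebesgue (halfcell e k) F"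
        by (intro set_integrable_cong) (use F n in auto)
      finally show ?thesis using set_integral_cell_eq_halfcell(1)[OF assms(2)] by blast
    qed
    show "F t = 0" if k: "\<lfloor>t / e\<rfloor> \<notin> int ` {..<?M}" for t
    proof (cases "t \<ge> 0")
      case True
      then have "\<lfloor>t / e\<rfloor> \<ge> 0" using assms by simp
      then obtain n where n: "\<lfloor>t / e\<rfloor> = int n" using nonneg_int_cases by blast
      with k have "n \<ge> Suc N" by auto
      then have "G t x = 0" for x
        by (intro vanishes_beyond_cell[OF v assms(1,2), of n "\<lfloor>x / d\<rfloor>"])
          (use fl(1)[of t] fl(2)[of x] n in auto)
      then show ?thesis by (simp add: F_def)
    qed (simp add: F_def)
  qed simp
  also have "\<dots> = (\<Sum>k<?M. LINT t:cell e (int k)|lebesgue. F t)"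
    by (simp add: sum.reindex)
  also have "\<dots> = (\<Sum>k<?M. LINT t:cell e (int k)|lebesgue. \<Sum>i\<in>?I. LINT x:cell d i|lebesgue. g k i t x)"
    by (intro sum.cong refl set_integral_cell_cong assms) (use F in auto)
  also have "\<dots> = (\<Sum>k<?M. \<Sum>i\<in>?I. cell_integral d e (g k i) k i)"
    unfolding cell_integral_def
    by (intro sum.cong refl set_integral_sum(2)) (use set_integrable_cell_time[OF c assms(1,2)] in auto)
  also have "\<dots> = grid_sum (\<lambda>k i. cell_integral d e (g k i) k i)"
  proof (rule grid_sum_eq_sum[symmetric])
    fix k i assume *: "k \<ge> Suc N \<or> \<bar>i\<bar> \<ge> int (Suc N)"
    have "cell_integral d e (g k i) k i = cell_integral d e (\<lambda>_ _. 0) k i"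
    proof (intro cell_integral_cong assms)
      fix t x assume "t \<in> halfcell e (int k)" "x \<in> halfcell d i"
      then show "g k i t x = 0"
        using eq[of t k x i] vanishes_beyond_cell[OF v assms(1,2) *, of t x]
          subsetD[OF halfcell_subset_cell] by metis
    qed
    then show "cell_integral d e (g k i) k i = 0" by (simp add: cell_integral_def)
  qed
  finally show ?thesis .
qed

section \<open>The weak equations as grid identities\<close>

lemma at_within_Ici_neq_bot: "t \<ge> (0::real) \<Longrightarrow> at t within {0..} \<noteq> bot"
  using at_le[of "{t<..}" "{0..}" t] trivial_limit_at_right_real[of t]
  by (auto simp: bot_unique subset_iff)

text \<open>The first derivatives vanish where \<open>\<phi>\<close> vanishes in a neighbourhood, relative to the half
  plane in the case of \<open>D_t\<close>.\<close>
lemma compact_support_vanishes: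
  assumes "compact_support_halfplane \<phi>" "d > 0" "e > 0"
  obtains N where "vanishes_beyond d e N \<phi>" "vanishes_beyond d e N (D_t \<phi>)" "vanishes_beyond d e N (D_x \<phi>)"
proof -
  have "bounded (closure {(t, x). 0 \<le> t \<and> \<phi> t x \<noteq> 0})"
    using assms(1) by (simp add: compact_support_halfplane_def compact_imp_bounded)
  then obtain B where B: "\<And>p. p \<in> closure {(t, x). 0 \<le> t \<and> \<phi> t x \<noteq> 0} \<Longrightarrow> norm p \<le> B"
    by (auto simp: bounded_iff)
  have z: "\<phi> t x = 0" if "t \<ge> 0" "t > B \<or> \<bar>x\<bar> > B" for t x
  proof (rule ccontr)
    assume "\<phi> t x \<noteq> 0"
    then have "(t, x) \<in> closure {(t, x). 0 \<le> t \<and> \<phi> t x \<noteq> 0}"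
      using that(1) by (intro subsetD[OF closure_subset]) simp
    then have "norm (t, x) \<le> B" by (rule B)
    moreover have "\<bar>t\<bar> \<le> norm (t, x)" "\<bar>x\<bar> \<le> norm (t, x)"
      using norm_fst_le[of t x] norm_snd_le[of x t] by auto
    ultimately show False using that by linarith
  qed
  have zt: "D_t \<phi> t x = 0" if "t \<ge> 0" "t > B \<or> \<bar>x\<bar> > B" for t x
    unfolding D_t_def
  proof (rule vector_derivative_within[OF at_within_Ici_neq_bot[OF that(1)]])
    show "((\<lambda>\<tau>. \<phi> \<tau> x) has_vector_derivative 0) (at t within {0..})"
      by (rule has_vector_derivative_transform_within[OF has_vector_derivative_const,
            of "if t > B then t - B else 1"])
        (use that in \<open>auto intro!: z[symmetric] simp: dist_real_def split: if_splits\<close>)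
  qed
  have zx: "D_x \<phi> t x = 0" if "t \<ge> 0" "t > B \<or> \<bar>x\<bar> > B" for t x
    unfolding D_x_def
  proof (rule vector_derivative_at)
    show "(\<phi> t has_vector_derivative 0) (at x)"
      by (rule has_vector_derivative_transform_within[OF has_vector_derivative_const,
            of "if t > B then 1 else \<bar>x\<bar> - B"])
        (use that z in \<open>auto simp: dist_real_def split: if_splits\<close>)
  qed
  obtain N1 N2 where N: "B < real N1 * d" "B < real N2 * e"
    using reals_Archimedean3[OF assms(2)] reals_Archimedean3[OF assms(3)] by metis
  define N where "N = max N1 N2"
  have "real N1 * d \<le> real N * d" "real N2 * e \<le> real N * e"
    using assms by (auto simp: N_def)
  then have far: "t > B \<or> \<bar>x\<bar> > B" if "t \<ge> real N * e \<or> \<bar>x\<bar> \<ge> real N * d" for t x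
    using N that by linarith
  show thesis
    by (rule that[of N]) (use z zt zx far in \<open>auto simp: vanishes_beyond_def\<close>)
qed

lemma grid_fun_halfcell:
  assumes "d > 0" "e > 0" "t \<in> halfcell e (int k)" "x \<in> halfcell d i"
  shows "grid_fun d e u t x = u k i"
  using assms by (intro grid_fun_eq) (auto simp: halfcell_def algebra_simps)

text \<open>The weak form of a conservative recursion with flux \<open>f\<close>: multiply the recursion by \<open>d y\<close>, sum,
  and move the differences onto \<open>y\<close>.\<close>
lemma summation_by_parts_in_time:
  assumes "fin_supp y" "d \<noteq> 0"
    and rec: "\<And>k i. u (k + 1) i = u k i + e / d * (f k (i - 1) - f k i)"
  shows "e * grid_sum (\<lambda>k i. f k i * (y k (i + 1) - y k i))
       + d * grid_sum (\<lambda>k i. u (k + 1) i * (y (k + 1) i - y k i)) + d * (\<Sum>\<^sub>\<infinity>i. u 0 i * y 0 i) = 0"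
proof -
  note fs = fin_supp_mult_left fin_supp_shifts assms(1)
  have 1: "grid_sum (\<lambda>k i. f k i * (y k (i + 1) - y k i)) = grid_sum (\<lambda>k i. f k (i - 1) * y k i) - grid_sum (\<lambda>k i. f k i * y k i)"
  proof -
    have "grid_sum (\<lambda>k i. f k i * (y k (i + 1) - y k i)) = grid_sum (\<lambda>k i. f k i * y k (i + 1)) - grid_sum (\<lambda>k i. f k i * y k i)"
      by (simp only: right_diff_distrib) (intro grid_sum_diff fs)
    also have "grid_sum (\<lambda>k i. f k i * y k (i + 1)) = grid_sum (\<lambda>k i. f k (i - 1) * y k i)"
      using grid_sum_shift_space(1)[of "\<lambda>k i. f k i * y k (i + 1)"] by simp
    finally show ?thesis .
  qed
  have 2: "grid_sum (\<lambda>k i. u (k + 1) i * (y (k + 1) i - y k i))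
      = grid_sum (\<lambda>k i. u (k + 1) i * y (k + 1) i) - grid_sum (\<lambda>k i. u (k + 1) i * y k i)"
    by (simp only: right_diff_distrib) (intro grid_sum_diff fs)
  have 3: "grid_sum (\<lambda>k i. u k i * y k i) = (\<Sum>\<^sub>\<infinity>i. u 0 i * y 0 i) + grid_sum (\<lambda>k i. u (k + 1) i * y (k + 1) i)"
    by (intro grid_sum_shift_time fs)
  have "d * grid_sum (\<lambda>k i. u (k + 1) i * y k i)
      = grid_sum (\<lambda>k i. d * (u k i * y k i) + (e * (f k (i - 1) * y k i) - e * (f k i * y k i)))"
    by (subst grid_sum_cmult[symmetric], rule arg_cong[where f = grid_sum]) (use assms(2) in \<open>simp only: rec, auto simp: fun_eq_iff field_simps\<close>)
  also have "\<dots> = d * grid_sum (\<lambda>k i. u k i * y k i) + (e * grid_sum (\<lambda>k i. f k (i - 1) * y k i) - e * grid_sum (\<lambda>k i. f k i * y k i))"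
    by (simp only: grid_sum_cmult[symmetric], subst grid_sum_add grid_sum_diff, (intro fs fin_supp_diff)+, subst grid_sum_diff, (intro fs)+, rule refl)
  finally have 4: "d * grid_sum (\<lambda>k i. u (k + 1) i * y k i) = d * grid_sum (\<lambda>k i. u k i * y k i)
      + (e * grid_sum (\<lambda>k i. f k (i - 1) * y k i) - e * grid_sum (\<lambda>k i. f k i * y k i))" .
  show ?thesis unfolding 1 2 using 4 unfolding 3 by (simp add: algebra_simps)
qed

lemma cont_halfplane_lincomb:
  "cont_halfplane f \<Longrightarrow> cont_halfplane g \<Longrightarrow> cont_halfplane (\<lambda>t x. a * f t x + b * g t x)"
  unfolding cont_halfplane_def case_prod_beta by (intro continuous_on_add continuous_on_mult continuous_on_const)

declare \<rho>_seq.simps [simp del]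

text \<open>The bound \<open>N\<close> on the supports is fixed once, so that all finiteness facts refer to the same
  region.\<close>
locale scheme_test_function =
  fixes \<kappa> h \<rho>0 :: "real \<Rightarrow> real" and \<delta>x \<delta>t :: real and \<phi> :: "real \<Rightarrow> real \<Rightarrow> real" and N :: nat
  assumes dx: "\<delta>x > 0" and dt: "\<delta>t > 0"
    and C2: "C2_halfplane \<phi>"
    and van: "vanishes_beyond \<delta>x \<delta>t N \<phi>" "vanishes_beyond \<delta>x \<delta>t N (D_t \<phi>)"
      "vanishes_beyond \<delta>x \<delta>t N (D_x \<phi>)"
begin

abbreviation r where "r \<equiv> \<rho>_seq \<kappa> h \<delta>x \<delta>t \<rho>0"
abbreviation w where "w \<equiv> w_seq \<kappa> h \<delta>x \<delta>t \<rho>0"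
abbreviation J where "J \<equiv> cell_integral \<delta>x \<delta>t"
abbreviation node :: "(real \<Rightarrow> real \<Rightarrow> real) \<Rightarrow> nat \<Rightarrow> int \<Rightarrow> real" where
  "node \<psi> k i \<equiv> \<psi> (of_nat k * \<delta>t) (of_int i * \<delta>x)"

lemmas \<phi> = C2_halfplane_C1[OF C2] C2
lemmas cont = C1_halfplane_cont(1)[OF \<phi>(1)] C1_halfplane_cont(1)[OF \<phi>(2)] C1_halfplane_cont(1)[OF \<phi>(3)]
lemmas fs_J = fin_supp_cell_integral[OF van(1) dx dt] fin_supp_cell_integral[OF van(2) dx dt] fin_supp_cell_integral[OF van(3) dx dt]
lemmas fs_node = fin_supp_nodes[OF van(1) dx dt] fin_supp_nodes[OF van(2) dx dt] fin_supp_nodes[OF van(3) dx dt]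

lemma node_le: "x \<in> halfcell \<delta>x i \<Longrightarrow> of_int i * \<delta>x \<le> x"
  "t \<in> halfcell \<delta>t (int k) \<Longrightarrow> of_nat k * \<delta>t \<le> t"
  by (auto simp: halfcell_def)

lemma node_time_nonneg: "0 \<le> of_nat k * \<delta>t"
  using dt by simp

lemma \<rho>_grid_halfcell: "t \<in> halfcell \<delta>t (int k) \<Longrightarrow> x \<in> halfcell \<delta>x i \<Longrightarrow> \<rho>_grid \<kappa> h \<delta>x \<delta>t \<rho>0 t x = r k i"
  and w_grid_halfcell: "t \<in> halfcell \<delta>t (int k) \<Longrightarrow> x \<in> halfcell \<delta>x i \<Longrightarrow> w_grid \<kappa> h \<delta>x \<delta>t \<rho>0 t x = w k i"
  by (simp_all add: \<rho>_grid_def w_grid_def grid_fun_halfcell dx dt)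

text \<open>The common form of the errors made when a function is replaced on a cell by its value at
  the corner: the two one-dimensional integrals add up to the increment from the corner.\<close>
lemma J_increment:
  assumes "C1_halfplane \<psi>"
    and g: "\<And>t x. t \<in> halfcell \<delta>t (int k) \<Longrightarrow> x \<in> halfcell \<delta>x i \<Longrightarrow> g t x = c"
  shows "(LINT t:cell \<delta>t (int k)|lebesgue. LINT x:cell \<delta>x i|lebesgue.
            ((LINT s:{of_int i * \<delta>x..x}|lebesgue. D_x \<psi> t s)
             + (LINT \<tau>:{of_nat k * \<delta>t..t}|lebesgue. D_t \<psi> \<tau> (of_int i * \<delta>x))) * g t x)
       = (J \<psi> k i - \<delta>t * \<delta>x * node \<psi> k i) * c"
proof -
  have "J (\<lambda>t x. ((LINT s:{of_int i * \<delta>x..x}|lebesgue. D_x \<psi> t s)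
             + (LINT \<tau>:{of_nat k * \<delta>t..t}|lebesgue. D_t \<psi> \<tau> (of_int i * \<delta>x))) * g t x) k i
      = J (\<lambda>t x. (\<psi> t x - node \<psi> k i) * c) k i"
    by (rule cell_integral_cong[OF dx dt])
      (simp add: g FTC_space[OF assms(1)] FTC_time[OF assms(1)] node_le halfcell_nonneg[OF dt] node_time_nonneg)
  also have "\<dots> = (J \<psi> k i - \<delta>t * \<delta>x * node \<psi> k i) * c"
    by (simp only: cell_integral_mult_right cell_integral_diff[OF dx dt C1_halfplane_cont(1)[OF assms(1)] cont_halfplane_const]
        cell_integral_const[OF dx dt])
  finally show ?thesis by (simp only: cell_integral_def)
qed

lemma continuity_main_part:
  "(LINT t:{0..}|lebesgue. LINT x|lebesgue.
       \<rho>_grid \<kappa> h \<delta>x \<delta>t \<rho>0 t x * (w_grid \<kappa> h \<delta>x \<delta>t \<rho>0 t x * D_x \<phi> t x + D_t \<phi> t x))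
   = grid_sum (\<lambda>k i. r k i * w k i * J (D_x \<phi>) k i + r k i * J (D_t \<phi>) k i)"
proof -
  have "(LINT t:{0..}|lebesgue. LINT x|lebesgue.
       \<rho>_grid \<kappa> h \<delta>x \<delta>t \<rho>0 t x * (w_grid \<kappa> h \<delta>x \<delta>t \<rho>0 t x * D_x \<phi> t x + D_t \<phi> t x))
     = grid_sum (\<lambda>k i. J (\<lambda>t x. (r k i * w k i) * D_x \<phi> t x + r k i * D_t \<phi> t x) k i)"
    by (rule space_time_integral_cells[where N = N, OF dx dt])
      (use van in \<open>auto simp: \<rho>_grid_halfcell w_grid_halfcell vanishes_beyond_def distrib_left
        intro: cont_halfplane_lincomb cont\<close>)
  then show ?thesis by (simp only: cell_integral_lincomb[OF dx dt cont(3) cont(2)])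
qed

lemma integral_initial_cells:
  assumes "integrable lebesgue \<rho>0"
  shows "(\<lambda>i. LINT x:cell \<delta>x i|lebesgue. \<phi> 0 x * \<rho>0 x) summable_on UNIV"
    and "(\<Sum>\<^sub>\<infinity>i. LINT x:cell \<delta>x i|lebesgue. \<phi> 0 x * \<rho>0 x) = (LINT x|lebesgue. \<phi> 0 x * \<rho>0 x)"
    and "integrable lebesgue (\<lambda>x. \<phi> 0 x * \<rho>0 x)"
proof -
  let ?I = "{- int (Suc N)..<int (Suc N)}" and ?a = "real N * \<delta>x"
  have z: "\<phi> 0 x = 0" if "i \<notin> ?I" "x \<in> cell \<delta>x i" for x i
    by (rule vanishes_beyond_cell[OF van(1) dx dt, of 0 i]) (use that dt in \<open>auto simp: cell_def\<close>)
  have c: "continuous_on S (\<phi> 0)" for S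
    by (rule cont_halfplane_slices(1)[OF cont(1)]) simp
  have "bounded (\<phi> 0 ` {- ?a..?a})" by (intro compact_imp_bounded compact_continuous_image c) simp
  then obtain C where C: "\<And>x. x \<in> {- ?a..?a} \<Longrightarrow> \<bar>\<phi> 0 x\<bar> \<le> C" by (fastforce simp: bounded_iff)
  have bd: "\<bar>\<phi> 0 x\<bar> \<le> \<bar>C\<bar>" for x
  proof (cases "x \<in> {- ?a..?a}")
    case True then show ?thesis using C[of x] by linarith
  next
    case False
    then have "\<phi> 0 x = 0" using van(1) by (auto simp: vanishes_beyond_def)
    then show ?thesis by simp
  qed
  have m: "\<phi> 0 \<in> borel_measurable lebesgue"
    using borel_measurable_continuous_onI[OF c[of UNIV]] by (intro measurable_completion) simp
  show int: "integrable lebesgue (\<lambda>x. \<phi> 0 x * \<rho>0 x)"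
  proof (rule Bochner_Integration.integrable_bound)
    show "integrable lebesgue (\<lambda>x. \<bar>C\<bar> * \<rho>0 x)" using assms by simp
    show "(\<lambda>x. \<phi> 0 x * \<rho>0 x) \<in> borel_measurable lebesgue" using m assms by measurable
    show "AE x in lebesgue. norm (\<phi> 0 x * \<rho>0 x) \<le> norm (\<bar>C\<bar> * \<rho>0 x)"
      using bd by (intro AE_I2) (simp add: abs_mult mult_right_mono)
  qed
  have z': "(LINT x:cell \<delta>x i|lebesgue. \<phi> 0 x * \<rho>0 x) = 0" if "i \<notin> ?I" for i
    using set_integral_cell_cong[OF dx, of i "\<lambda>x. \<phi> 0 x * \<rho>0 x" "\<lambda>_. 0"] z[OF that]
      halfcell_subset_cell[of \<delta>x i] by (auto simp: subset_iff)
  show "(\<lambda>i. LINT x:cell \<delta>x i|lebesgue. \<phi> 0 x * \<rho>0 x) summable_on UNIV"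
    by (rule finite_nonzero_values_imp_summable_on, rule finite_subset[of _ ?I]) (use z' in blast, simp)
  have "(\<Sum>\<^sub>\<infinity>i. LINT x:cell \<delta>x i|lebesgue. \<phi> 0 x * \<rho>0 x)
      = (\<Sum>i\<in>?I. LINT x:cell \<delta>x i|lebesgue. \<phi> 0 x * \<rho>0 x)"
    by (subst infsum_finite[symmetric], simp, rule infsum_cong_neutral) (use z' in auto)
  also have "\<dots> = (LINT x|lebesgue. \<phi> 0 x * \<rho>0 x)"
  proof (rule integral_finite_cells(2)[symmetric, OF dx])
    show "\<phi> 0 x * \<rho>0 x = 0" if "\<lfloor>x / \<delta>x\<rfloor> \<notin> ?I" for x
      using z[OF that, of x] mem_halfcell_iff[OF dx, of x "\<lfloor>x / \<delta>x\<rfloor>"] halfcell_subset_cell by auto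
  qed (use set_integrable_cell[OF int] in auto)
  finally show "(\<Sum>\<^sub>\<infinity>i. LINT x:cell \<delta>x i|lebesgue. \<phi> 0 x * \<rho>0 x) = (LINT x|lebesgue. \<phi> 0 x * \<rho>0 x)" .
qed

lemma initial_increment:
  assumes "integrable lebesgue \<rho>0"
  shows "(LINT x:cell \<delta>x i|lebesgue. LINT l:{of_int i * \<delta>x..x}|lebesgue. \<rho>0 x * D_x \<phi> 0 l)
    = (LINT x:cell \<delta>x i|lebesgue. \<phi> 0 x * \<rho>0 x) - \<delta>x * (r 0 i * node \<phi> 0 i)"
proof -
  have "(LINT x:cell \<delta>x i|lebesgue. LINT l:{of_int i * \<delta>x..x}|lebesgue. \<rho>0 x * D_x \<phi> 0 l)
     = (LINT x:cell \<delta>x i|lebesgue. \<phi> 0 x * \<rho>0 x - node \<phi> 0 i * \<rho>0 x)"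
    by (rule set_integral_cell_cong[OF dx])
      (simp add: FTC_space[OF \<phi>(1) order_refl node_le(1)] left_diff_distrib mult.commute[of "\<rho>0 _"])
  also have "\<dots> = (LINT x:cell \<delta>x i|lebesgue. \<phi> 0 x * \<rho>0 x) - (LINT x:cell \<delta>x i|lebesgue. node \<phi> 0 i * \<rho>0 x)"
    using assms integral_initial_cells(3)[OF assms]
    by (intro set_integral_diff set_integrable_cell) auto
  also have "(LINT x:cell \<delta>x i|lebesgue. node \<phi> 0 i * \<rho>0 x) = \<delta>x * (r 0 i * node \<phi> 0 i)"
    using dx by (simp add: \<rho>_seq.simps)
  finally show ?thesis .
qed

text \<open>The inner integrals are evaluated term by term, in the order of the definition, so that the
  error becomes a linear expression in grid sums.\<close>
lemma P1_eq:
  assumes "integrable lebesgue \<rho>0"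
  shows "P1 \<kappa> h \<delta>x \<delta>t \<rho>0 \<phi> =
    - (\<Sum>\<^sub>\<infinity>i. \<delta>t * \<delta>x * (r 0 i * node (D_t \<phi>) 0 i))
    + \<delta>t * grid_sum (\<lambda>k i. r k (i - 1) * w k (i - 1) * (node \<phi> k i - node \<phi> k (i - 1) - \<delta>x * node (D_x \<phi>) k (i - 1)))
    + \<delta>x * grid_sum (\<lambda>k i. r (k + 1) i * (node \<phi> (k + 1) i - node \<phi> k i - \<delta>t * node (D_t \<phi>) k i))
    - (\<Sum>\<^sub>\<infinity>i. (LINT x:cell \<delta>x i|lebesgue. \<phi> 0 x * \<rho>0 x) - \<delta>x * (r 0 i * node \<phi> 0 i))
    - grid_sum (\<lambda>k i. (J (D_t \<phi>) k i - \<delta>t * \<delta>x * node (D_t \<phi>) k i) * r k i)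
    - grid_sum (\<lambda>k i. (J (D_x \<phi>) k (i - 1) - \<delta>t * \<delta>x * node (D_x \<phi>) k (i - 1)) * (r k (i - 1) * w k (i - 1)))
    - grid_sum (\<lambda>k i. \<delta>t * \<delta>x * ((node (D_t \<phi>) (k + 1) i - node (D_t \<phi>) k i) * r (k + 1) i))"
proof -
  let ?\<rho> = "\<rho>_grid \<kappa> h \<delta>x \<delta>t \<rho>0" and ?w = "w_grid \<kappa> h \<delta>x \<delta>t \<rho>0"
  have t1: "(LINT t:{0..\<delta>t}|lebesgue. LINT x:cell \<delta>x i|lebesgue. D_t \<phi> 0 (of_int i * \<delta>x) * ?\<rho> t x)
      = \<delta>t * \<delta>x * (r 0 i * node (D_t \<phi>) 0 i)" for i
  proof -
    have "J (\<lambda>t x. D_t \<phi> 0 (of_int i * \<delta>x) * ?\<rho> t x) 0 i = J (\<lambda>t x. r 0 i * node (D_t \<phi>) 0 i) 0 i"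
      by (rule cell_integral_cong[OF dx dt]) (simp add: \<rho>_grid_halfcell[of _ 0, simplified])
    then show ?thesis unfolding cell_integral_const[OF dx dt] by (simp add: cell_integral_def cell_def)
  qed
  have t2: "(LINT \<xi>:cell \<delta>x (i - 1)|lebesgue. LINT s:{of_int (i - 1) * \<delta>x..\<xi>}|lebesgue.
             D_x (D_x \<phi>) (of_nat k * \<delta>t) s)
      = node \<phi> k i - node \<phi> k (i - 1) - \<delta>x * node (D_x \<phi>) k (i - 1)" for k i
    unfolding cell_def using dx
    by (subst Taylor_space[OF \<phi>(4) node_time_nonneg]) (auto simp: algebra_simps)
  have t3: "(LINT \<tau>:cell \<delta>t (int k)|lebesgue. LINT l:{of_nat k * \<delta>t..\<tau>}|lebesgue. D_t (D_t \<phi>) l (of_int i * \<delta>x))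
      = node \<phi> (k + 1) i - node \<phi> k i - \<delta>t * node (D_t \<phi>) k i" for k i
    using Taylor_time[OF \<phi>(4) node_time_nonneg, of k "of_nat (k + 1) * \<delta>t" "of_int i * \<delta>x"] dt
    by (simp add: cell_def algebra_simps)
  note t4 = initial_increment[OF assms]
  have t5: "(LINT t:cell \<delta>t (int k)|lebesgue. LINT x:cell \<delta>x i|lebesgue.
            ((LINT s:{of_int i * \<delta>x..x}|lebesgue. D_x (D_t \<phi>) t s)
             + (LINT \<tau>:{of_nat k * \<delta>t..t}|lebesgue. D_t (D_t \<phi>) \<tau> (of_int i * \<delta>x))) * ?\<rho> t x)
      = (J (D_t \<phi>) k i - \<delta>t * \<delta>x * node (D_t \<phi>) k i) * r k i" for k i
    by (rule J_increment[OF \<phi>(2)]) (simp only: \<rho>_grid_halfcell)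
  have t6: "(LINT t:cell \<delta>t (int k)|lebesgue. LINT x:cell \<delta>x (i - 1)|lebesgue.
            ((LINT s:{of_int (i - 1) * \<delta>x..x}|lebesgue. D_x (D_x \<phi>) t s)
             + (LINT \<tau>:{of_nat k * \<delta>t..t}|lebesgue. D_t (D_x \<phi>) \<tau> (of_int (i - 1) * \<delta>x)))
            * ?\<rho> t x * ?w t x)
      = (J (D_x \<phi>) k (i - 1) - \<delta>t * \<delta>x * node (D_x \<phi>) k (i - 1)) * (r k (i - 1) * w k (i - 1))" for k i
    using J_increment[OF \<phi>(3), of k "i - 1" "\<lambda>t x. ?\<rho> t x * ?w t x"]
    by (simp add: \<rho>_grid_halfcell w_grid_halfcell mult.assoc)
  have t7: "(LINT t:cell \<delta>t (int k + 1)|lebesgue. LINT x:cell \<delta>x i|lebesgue.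
            (LINT \<tau>:cell \<delta>t (int k)|lebesgue. D_t (D_t \<phi>) \<tau> (of_int i * \<delta>x)) * ?\<rho> t x)
      = \<delta>t * \<delta>x * ((node (D_t \<phi>) (k + 1) i - node (D_t \<phi>) k i) * r (k + 1) i)" for k i
  proof -
    have "(LINT \<tau>:cell \<delta>t (int k)|lebesgue. D_t (D_t \<phi>) \<tau> (of_int i * \<delta>x))
        = node (D_t \<phi>) (k + 1) i - node (D_t \<phi>) k i"
      using FTC_time[OF \<phi>(2) node_time_nonneg, of k "of_nat (k + 1) * \<delta>t" "of_int i * \<delta>x"] dt
      by (simp add: cell_def algebra_simps)
    moreover have "J (\<lambda>t x. c * ?\<rho> t x) (k + 1) i = J (\<lambda>t x. c * r (k + 1) i) (k + 1) i" for c
      by (rule cell_integral_cong[OF dx dt]) (simp only: \<rho>_grid_halfcell)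
    ultimately show ?thesis
      unfolding cell_integral_const[OF dx dt] by (simp only: cell_integral_def of_nat_add of_nat_1)
  qed
  show ?thesis
    unfolding P1_def Let_def grid_sum_def t1 t2 t3 t4 t5 t6 t7 by (rule refl)
qed

text \<open>With every term expressed by grid sums, the cell integrals of \<open>D_t \<phi>\<close> and \<open>D_x \<phi>\<close> cancel against
  the main part, the nodal derivatives cancel between the Taylor remainders and the corner
  errors, and the remaining nodal differences of \<open>\<phi>\<close> are the weak form of the recursion. The time
  shift between \<open>\<rho>\<^sup>k\<close> and \<open>\<rho>\<^sup>k\<^sup>+\<^sup>1\<close> in front of \<open>D_t \<phi>\<close> produces the first and the last term of the error.\<close>
lemma weak_continuity_equation:
  assumes "integrable lebesgue \<rho>0"
  shows "- (LINT x|lebesgue. \<phi> 0 x * \<rho>0 x) =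
     (LINT t:{0..}|lebesgue. LINT x|lebesgue.
       \<rho>_grid \<kappa> h \<delta>x \<delta>t \<rho>0 t x * (w_grid \<kappa> h \<delta>x \<delta>t \<rho>0 t x * D_x \<phi> t x + D_t \<phi> t x))
     + P1 \<kappa> h \<delta>x \<delta>t \<rho>0 \<phi>"
proof -
  define n nt nx Jt Jx f where defs: "n = node \<phi>" "nt = node (D_t \<phi>)" "nx = node (D_x \<phi>)"
    "Jt = J (D_t \<phi>)" "Jx = J (D_x \<phi>)" "f = (\<lambda>k i. r k i * w k i)"
  have fs_basic: "fin_supp n" "fin_supp nt" "fin_supp nx" "fin_supp Jt" "fin_supp Jx"
    unfolding defs using fs_J fs_node by auto
  note fs = fin_supp_mult_left fin_supp_mult_right fin_supp_diff fs_basic fin_supp_shifts[OF fs_basic(1)]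
    fin_supp_shifts[OF fs_basic(2)]
  have A: "grid_sum (\<lambda>k i. f k i * Jx k i + r k i * Jt k i) = grid_sum (\<lambda>k i. f k i * Jx k i) + grid_sum (\<lambda>k i. r k i * Jt k i)"
    by (intro grid_sum_add fs)
  have T2: "grid_sum (\<lambda>k i. f k (i - 1) * (n k i - n k (i - 1) - \<delta>x * nx k (i - 1)))
      = grid_sum (\<lambda>k i. f k i * (n k (i + 1) - n k i)) - \<delta>x * grid_sum (\<lambda>k i. f k i * nx k i)"
  proof -
    have "grid_sum (\<lambda>k i. f k (i - 1) * (n k i - n k (i - 1) - \<delta>x * nx k (i - 1)))
        = grid_sum (\<lambda>k i. f k i * (n k (i + 1) - n k i - \<delta>x * nx k i))"
      using grid_sum_shift_space(1)[of "\<lambda>k i. f k i * (n k (i + 1) - n k i - \<delta>x * nx k i)"] by simp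
    also have "\<dots> = grid_sum (\<lambda>k i. f k i * (n k (i + 1) - n k i) - \<delta>x * (f k i * nx k i))"
      by (simp add: algebra_simps)
    also have "\<dots> = grid_sum (\<lambda>k i. f k i * (n k (i + 1) - n k i)) - \<delta>x * grid_sum (\<lambda>k i. f k i * nx k i)"
      by (subst grid_sum_diff) (intro fs, intro fs, simp only: grid_sum_cmult)
    finally show ?thesis .
  qed
  have T3: "grid_sum (\<lambda>k i. r (k + 1) i * (n (k + 1) i - n k i - \<delta>t * nt k i))
      = grid_sum (\<lambda>k i. r (k + 1) i * (n (k + 1) i - n k i)) - \<delta>t * grid_sum (\<lambda>k i. r (k + 1) i * nt k i)"
  proof -
    have "grid_sum (\<lambda>k i. r (k + 1) i * (n (k + 1) i - n k i - \<delta>t * nt k i))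
        = grid_sum (\<lambda>k i. r (k + 1) i * (n (k + 1) i - n k i) - \<delta>t * (r (k + 1) i * nt k i))"
      by (simp only: right_diff_distrib mult.left_commute)
    also have "\<dots> = grid_sum (\<lambda>k i. r (k + 1) i * (n (k + 1) i - n k i)) - \<delta>t * grid_sum (\<lambda>k i. r (k + 1) i * nt k i)"
      by (subst grid_sum_diff) (intro fs, intro fs, simp only: grid_sum_cmult)
    finally show ?thesis .
  qed
  have T4: "(\<Sum>\<^sub>\<infinity>i. (LINT x:cell \<delta>x i|lebesgue. \<phi> 0 x * \<rho>0 x) - \<delta>x * (r 0 i * n 0 i))
      = (LINT x|lebesgue. \<phi> 0 x * \<rho>0 x) - \<delta>x * (\<Sum>\<^sub>\<infinity>i. r 0 i * n 0 i)"
  proof -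
    have "(\<lambda>i. \<delta>x * (r 0 i * n 0 i)) summable_on UNIV"
      by (rule fin_supp_summable(1)[where f = "\<lambda>k i. \<delta>x * (r k i * n k i)"]) (intro fs)
    then have "(\<Sum>\<^sub>\<infinity>i. (LINT x:cell \<delta>x i|lebesgue. \<phi> 0 x * \<rho>0 x) - \<delta>x * (r 0 i * n 0 i))
      = (\<Sum>\<^sub>\<infinity>i. LINT x:cell \<delta>x i|lebesgue. \<phi> 0 x * \<rho>0 x) - (\<Sum>\<^sub>\<infinity>i. \<delta>x * (r 0 i * n 0 i))"
      using infsum_add[OF integral_initial_cells(1)[OF assms], of "\<lambda>i. - (\<delta>x * (r 0 i * n 0 i))"]
      by (simp only: summable_on_uminus infsum_uminus diff_conv_add_uminus)
    then show ?thesis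
      by (simp only: integral_initial_cells(2)[OF assms] infsum_cmult_right')
  qed
  have T5: "grid_sum (\<lambda>k i. (Jt k i - \<delta>t * \<delta>x * nt k i) * r k i)
      = grid_sum (\<lambda>k i. r k i * Jt k i) - \<delta>t * \<delta>x * grid_sum (\<lambda>k i. r k i * nt k i)"
  proof -
    have "grid_sum (\<lambda>k i. (Jt k i - \<delta>t * \<delta>x * nt k i) * r k i) = grid_sum (\<lambda>k i. r k i * Jt k i - (\<delta>t * \<delta>x) * (r k i * nt k i))"
      by (simp add: algebra_simps)
    also have "\<dots> = grid_sum (\<lambda>k i. r k i * Jt k i) - \<delta>t * \<delta>x * grid_sum (\<lambda>k i. r k i * nt k i)"
      by (subst grid_sum_diff) (intro fs, intro fs, simp only: grid_sum_cmult)
    finally show ?thesis .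
  qed
  have T6: "grid_sum (\<lambda>k i. (Jx k (i - 1) - \<delta>t * \<delta>x * nx k (i - 1)) * f k (i - 1))
      = grid_sum (\<lambda>k i. f k i * Jx k i) - \<delta>t * \<delta>x * grid_sum (\<lambda>k i. f k i * nx k i)"
  proof -
    have "grid_sum (\<lambda>k i. (Jx k (i - 1) - \<delta>t * \<delta>x * nx k (i - 1)) * f k (i - 1))
        = grid_sum (\<lambda>k i. (Jx k i - \<delta>t * \<delta>x * nx k i) * f k i)"
      by (rule grid_sum_shift_space(1)[of "\<lambda>k i. (Jx k i - \<delta>t * \<delta>x * nx k i) * f k i"])
    also have "\<dots> = grid_sum (\<lambda>k i. f k i * Jx k i - (\<delta>t * \<delta>x) * (f k i * nx k i))"
      by (simp add: algebra_simps)
    also have "\<dots> = grid_sum (\<lambda>k i. f k i * Jx k i) - \<delta>t * \<delta>x * grid_sum (\<lambda>k i. f k i * nx k i)"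
      by (subst grid_sum_diff) (intro fs, intro fs, simp only: grid_sum_cmult)
    finally show ?thesis .
  qed
  have T7: "grid_sum (\<lambda>k i. \<delta>t * \<delta>x * ((nt (k + 1) i - nt k i) * r (k + 1) i))
      = \<delta>t * \<delta>x * (grid_sum (\<lambda>k i. r (k + 1) i * nt (k + 1) i) - grid_sum (\<lambda>k i. r (k + 1) i * nt k i))"
    unfolding grid_sum_cmult
    by (subst grid_sum_diff[symmetric]) (intro fs, intro fs, simp only: left_diff_distrib mult.commute)
  have S: "grid_sum (\<lambda>k i. r k i * nt k i) = (\<Sum>\<^sub>\<infinity>i. r 0 i * nt 0 i) + grid_sum (\<lambda>k i. r (k + 1) i * nt (k + 1) i)"
    by (intro grid_sum_shift_time fs)
  have rec: "r (k + 1) i = r k i + \<delta>t / \<delta>x * (f k (i - 1) - f k i)" for k i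
    by (simp add: defs w_seq_def Let_def \<rho>_seq.simps)
  have D: "\<delta>t * grid_sum (\<lambda>k i. f k i * (n k (i + 1) - n k i))
       + \<delta>x * grid_sum (\<lambda>k i. r (k + 1) i * (n (k + 1) i - n k i)) + \<delta>x * (\<Sum>\<^sub>\<infinity>i. r 0 i * n 0 i) = 0"
    by (rule summation_by_parts_in_time[OF fs_basic(1), where f = f]) (use dx rec in auto)
  have M: "(LINT t:{0..}|lebesgue. LINT x|lebesgue.
       \<rho>_grid \<kappa> h \<delta>x \<delta>t \<rho>0 t x * (w_grid \<kappa> h \<delta>x \<delta>t \<rho>0 t x * D_x \<phi> t x + D_t \<phi> t x))
     = grid_sum (\<lambda>k i. f k i * Jx k i + r k i * Jt k i)"
    unfolding continuity_main_part defs ..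
  have P: "P1 \<kappa> h \<delta>x \<delta>t \<rho>0 \<phi> = - (\<delta>t * \<delta>x * (\<Sum>\<^sub>\<infinity>i. r 0 i * nt 0 i))
    + \<delta>t * grid_sum (\<lambda>k i. f k (i - 1) * (n k i - n k (i - 1) - \<delta>x * nx k (i - 1)))
    + \<delta>x * grid_sum (\<lambda>k i. r (k + 1) i * (n (k + 1) i - n k i - \<delta>t * nt k i))
    - (\<Sum>\<^sub>\<infinity>i. (LINT x:cell \<delta>x i|lebesgue. \<phi> 0 x * \<rho>0 x) - \<delta>x * (r 0 i * n 0 i))
    - grid_sum (\<lambda>k i. (Jt k i - \<delta>t * \<delta>x * nt k i) * r k i)
    - grid_sum (\<lambda>k i. (Jx k (i - 1) - \<delta>t * \<delta>x * nx k (i - 1)) * f k (i - 1))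
    - grid_sum (\<lambda>k i. \<delta>t * \<delta>x * ((nt (k + 1) i - nt k i) * r (k + 1) i))"
    unfolding P1_eq[OF assms] defs infsum_cmult_right' ..
  show ?thesis
    unfolding M P A T2 T3 T4 T5 T6 T7 using D S by (simp add: algebra_simps)
qed

lemma velocity_main_part:
  assumes \<beta>: "\<And>s. \<beta> (h s) = s"
  shows "(LINT t:{0..}|lebesgue. LINT x|lebesgue.
       \<phi> t x * \<beta> (w_grid \<kappa> h \<delta>x \<delta>t \<rho>0 t x) - D_x \<phi> t x * Q' \<kappa> (\<rho>_grid \<kappa> h \<delta>x \<delta>t \<rho>0 t x))
   = grid_sum (\<lambda>k i. \<beta> (w k i) * J \<phi> k i - Q' \<kappa> (r k i) * J (D_x \<phi>) k i)"
proof -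
  have "(LINT t:{0..}|lebesgue. LINT x|lebesgue.
       \<phi> t x * \<beta> (w_grid \<kappa> h \<delta>x \<delta>t \<rho>0 t x) - D_x \<phi> t x * Q' \<kappa> (\<rho>_grid \<kappa> h \<delta>x \<delta>t \<rho>0 t x))
     = grid_sum (\<lambda>k i. J (\<lambda>t x. \<beta> (w k i) * \<phi> t x + (- Q' \<kappa> (r k i)) * D_x \<phi> t x) k i)"
    by (rule space_time_integral_cells[where N = N, OF dx dt])
      (use van cont_halfplane_lincomb[OF cont(1) cont(3), of "\<beta> (w _ _)" "- Q' \<kappa> (r _ _)"] in
        \<open>auto simp: \<rho>_grid_halfcell w_grid_halfcell vanishes_beyond_def\<close>)
  then show ?thesis unfolding cell_integral_lincomb[OF dx dt cont(1) cont(3)] by simp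
qed

text \<open>Cell integral of \<open>D_x \<phi>\<close> frozen in space at the left end but not in time. In the second
  equation one error term compares \<open>D_x \<phi>\<close> with its frozen version, another the frozen version with
  the value at the corner of the cell to the left; \<open>L\<close> cancels between them.\<close>
abbreviation L :: "nat \<Rightarrow> int \<Rightarrow> real" where
  "L k i \<equiv> J (\<lambda>t x. D_x \<phi> t (of_int i * \<delta>x)) k i"

lemma fs_L: "fin_supp L"
proof (rule fin_suppI[of "Suc N"])
  fix k i assume *: "k \<ge> Suc N \<or> \<bar>i\<bar> \<ge> int (Suc N)"
  have "L k i = J (\<lambda>_ _. 0) k i"
    using vanishes_beyond_cell[OF van(3) dx dt * _ node_mem_cell[OF dx]] subsetD[OF halfcell_subset_cell]
    by (intro cell_integral_cong dx dt) blast
  then show "L k i = 0" by (simp add: cell_integral_def)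
qed

lemma P2_eq:
  shows "P2 \<kappa> h \<beta> \<delta>x \<delta>t \<rho>0 \<phi> =
    - grid_sum (\<lambda>k i. (J (D_x \<phi>) k i - L k i) * Q' \<kappa> (r k i))
    + grid_sum (\<lambda>k i. (J \<phi> k i - \<delta>t * \<delta>x * node \<phi> k i) * \<beta> (w k i))
    - grid_sum (\<lambda>k i. (L k (i + 1) - \<delta>t * \<delta>x * node (D_x \<phi>) k i) * Q' \<kappa> (r k (i + 1)))
    + \<delta>t * grid_sum (\<lambda>k i. Q' \<kappa> (r k (i + 1)) * (node \<phi> k (i + 1) - node \<phi> k i - \<delta>x * node (D_x \<phi>) k i))"
proof -
  let ?\<rho> = "\<rho>_grid \<kappa> h \<delta>x \<delta>t \<rho>0" and ?w = "w_grid \<kappa> h \<delta>x \<delta>t \<rho>0"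
  have t1: "(LINT t:cell \<delta>t (int k)|lebesgue. LINT x:cell \<delta>x i|lebesgue.
            (LINT s:{of_int i * \<delta>x..x}|lebesgue. D_x (D_x \<phi>) t s) * Q' \<kappa> (?\<rho> t x))
      = (J (D_x \<phi>) k i - L k i) * Q' \<kappa> (r k i)" for k i
  proof -
    have "J (\<lambda>t x. (LINT s:{of_int i * \<delta>x..x}|lebesgue. D_x (D_x \<phi>) t s) * Q' \<kappa> (?\<rho> t x)) k i
        = J (\<lambda>t x. (D_x \<phi> t x - D_x \<phi> t (of_int i * \<delta>x)) * Q' \<kappa> (r k i)) k i"
      by (rule cell_integral_cong[OF dx dt])
        (simp add: \<rho>_grid_halfcell FTC_space[OF \<phi>(3)] node_le halfcell_nonneg[OF dt])
    also have "\<dots> = (J (D_x \<phi>) k i - L k i) * Q' \<kappa> (r k i)"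
      by (simp only: cell_integral_mult_right cell_integral_diff[OF dx dt cont(3) cont_halfplane_trace[OF cont(3)]])
    finally show ?thesis by (simp only: cell_integral_def)
  qed
  have t2: "(LINT t:cell \<delta>t (int k)|lebesgue. LINT x:cell \<delta>x i|lebesgue.
            ((LINT \<tau>:{of_nat k * \<delta>t..t}|lebesgue. D_t \<phi> \<tau> (of_int i * \<delta>x))
             + (LINT \<xi>:{of_int i * \<delta>x..x}|lebesgue. D_x \<phi> t \<xi>)) * \<beta> (?w t x))
      = (J \<phi> k i - \<delta>t * \<delta>x * node \<phi> k i) * \<beta> (w k i)" for k i
    by (subst add.commute, rule J_increment[OF \<phi>(1)]) (simp only: w_grid_halfcell)
  have t3: "(LINT t:cell \<delta>t (int k)|lebesgue. LINT x:cell \<delta>x (i + 1)|lebesgue.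
            ((LINT s:cell \<delta>x i|lebesgue. D_x (D_x \<phi>) t s)
             + (LINT \<tau>:{of_nat k * \<delta>t..t}|lebesgue. D_t (D_x \<phi>) \<tau> (of_int i * \<delta>x))) * Q' \<kappa> (?\<rho> t x))
      = (L k (i + 1) - \<delta>t * \<delta>x * node (D_x \<phi>) k i) * Q' \<kappa> (r k (i + 1))" for k i
  proof -
    have "J (\<lambda>t x. ((LINT s:cell \<delta>x i|lebesgue. D_x (D_x \<phi>) t s)
             + (LINT \<tau>:{of_nat k * \<delta>t..t}|lebesgue. D_t (D_x \<phi>) \<tau> (of_int i * \<delta>x))) * Q' \<kappa> (?\<rho> t x)) k (i + 1)
        = J (\<lambda>t x. (D_x \<phi> t (of_int (i + 1) * \<delta>x) - node (D_x \<phi>) k i) * Q' \<kappa> (r k (i + 1))) k (i + 1)"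
    proof (rule cell_integral_cong[OF dx dt])
      fix t x assume t: "t \<in> halfcell \<delta>t (int k)" and x: "x \<in> halfcell \<delta>x (i + 1)"
      have "(LINT s:cell \<delta>x i|lebesgue. D_x (D_x \<phi>) t s)
          = D_x \<phi> t (of_int (i + 1) * \<delta>x) - D_x \<phi> t (of_int i * \<delta>x)"
        unfolding cell_def by (rule FTC_space[OF \<phi>(3) halfcell_nonneg[OF dt t]]) (use dx in simp)
      then show "((LINT s:cell \<delta>x i|lebesgue. D_x (D_x \<phi>) t s)
             + (LINT \<tau>:{of_nat k * \<delta>t..t}|lebesgue. D_t (D_x \<phi>) \<tau> (of_int i * \<delta>x))) * Q' \<kappa> (?\<rho> t x)
          = (D_x \<phi> t (of_int (i + 1) * \<delta>x) - node (D_x \<phi>) k i) * Q' \<kappa> (r k (i + 1))"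
        using t x by (simp add: \<rho>_grid_halfcell FTC_time[OF \<phi>(3) node_time_nonneg] node_le)
    qed
    also have "\<dots> = (L k (i + 1) - \<delta>t * \<delta>x * node (D_x \<phi>) k i) * Q' \<kappa> (r k (i + 1))"
      by (simp only: cell_integral_mult_right cell_integral_diff[OF dx dt cont_halfplane_trace[OF cont(3)] cont_halfplane_const]
          cell_integral_const[OF dx dt])
    finally show ?thesis by (simp only: cell_integral_def)
  qed
  have t4: "(LINT \<xi>:cell \<delta>x i|lebesgue. LINT s:{of_int i * \<delta>x..\<xi>}|lebesgue. D_x (D_x \<phi>) (of_nat k * \<delta>t) s)
      = node \<phi> k (i + 1) - node \<phi> k i - \<delta>x * node (D_x \<phi>) k i" for k i
    unfolding cell_def using dx
    by (subst Taylor_space[OF \<phi>(4) node_time_nonneg]) (auto simp: algebra_simps)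
  show ?thesis
    unfolding P2_def Let_def grid_sum_def t1 t2 t3 t4 by (rule refl)
qed

text \<open>As for the continuity equation, but the summation by parts is in space only: it moves the
  difference in \<open>\<delta>x \<beta>(w\<^sub>i) = Q'(\<rho>\<^sub>i) - Q'(\<rho>\<^sub>i\<^sub>+\<^sub>1)\<close> onto \<open>\<phi>\<close>.\<close>
lemma weak_velocity_equation:
  assumes \<beta>: "\<And>s. \<beta> (h s) = s"
  shows "(LINT t:{0..}|lebesgue. LINT x|lebesgue.
       \<phi> t x * \<beta> (w_grid \<kappa> h \<delta>x \<delta>t \<rho>0 t x) - D_x \<phi> t x * Q' \<kappa> (\<rho>_grid \<kappa> h \<delta>x \<delta>t \<rho>0 t x))
   = P2 \<kappa> h \<beta> \<delta>x \<delta>t \<rho>0 \<phi>"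
proof -
  define n nx J\<^sub>0 Jx l q b where defs: "n = node \<phi>" "nx = node (D_x \<phi>)" "J\<^sub>0 = J \<phi>" "Jx = J (D_x \<phi>)"
    "l = L" "q = (\<lambda>k i. Q' \<kappa> (r k i))" "b = (\<lambda>k i. \<beta> (w k i))"
  have fs_basic: "fin_supp n" "fin_supp nx" "fin_supp J\<^sub>0" "fin_supp Jx" "fin_supp l"
    unfolding defs using fs_J fs_node fs_L by auto
  note fs = fin_supp_mult_left fin_supp_mult_right fin_supp_diff fs_basic fin_supp_shifts[OF fs_basic(1)]
    fin_supp_shifts[OF fs_basic(5)]
  have b: "\<delta>x * b k i = q k i - q k (i + 1)" for k i
    using dx by (simp add: defs w_seq_def \<beta>)
  have T1: "grid_sum (\<lambda>k i. (Jx k i - l k i) * q k i) = grid_sum (\<lambda>k i. q k i * Jx k i) - grid_sum (\<lambda>k i. q k i * l k i)"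
    by (subst grid_sum_diff[symmetric]) (intro fs, intro fs, simp add: algebra_simps)
  have T2: "grid_sum (\<lambda>k i. (J\<^sub>0 k i - \<delta>t * \<delta>x * n k i) * b k i)
      = grid_sum (\<lambda>k i. b k i * J\<^sub>0 k i) - \<delta>t * (grid_sum (\<lambda>k i. q k i * n k i) - grid_sum (\<lambda>k i. q k (i + 1) * n k i))"
  proof -
    have "(J\<^sub>0 k i - \<delta>t * \<delta>x * n k i) * b k i = b k i * J\<^sub>0 k i - \<delta>t * (q k i * n k i - q k (i + 1) * n k i)" for k i
    proof -
      have "(J\<^sub>0 k i - \<delta>t * \<delta>x * n k i) * b k i = b k i * J\<^sub>0 k i - \<delta>t * ((\<delta>x * b k i) * n k i)"
        by (simp add: algebra_simps)
      then show ?thesis unfolding b by (simp only: left_diff_distrib)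
    qed
    then have "grid_sum (\<lambda>k i. (J\<^sub>0 k i - \<delta>t * \<delta>x * n k i) * b k i)
        = grid_sum (\<lambda>k i. b k i * J\<^sub>0 k i - \<delta>t * (q k i * n k i - q k (i + 1) * n k i))"
      by (simp only:)
    also have "\<dots> = grid_sum (\<lambda>k i. b k i * J\<^sub>0 k i) - \<delta>t * grid_sum (\<lambda>k i. q k i * n k i - q k (i + 1) * n k i)"
      by (subst grid_sum_diff) (intro fs, intro fs, simp only: grid_sum_cmult)
    also have "grid_sum (\<lambda>k i. q k i * n k i - q k (i + 1) * n k i)
        = grid_sum (\<lambda>k i. q k i * n k i) - grid_sum (\<lambda>k i. q k (i + 1) * n k i)"
      by (rule grid_sum_diff) (intro fs)+
    finally show ?thesis .
  qed
  have T3: "grid_sum (\<lambda>k i. (l k (i + 1) - \<delta>t * \<delta>x * nx k i) * q k (i + 1))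
      = grid_sum (\<lambda>k i. q k i * l k i) - \<delta>t * \<delta>x * grid_sum (\<lambda>k i. q k (i + 1) * nx k i)"
  proof -
    have "grid_sum (\<lambda>k i. (l k (i + 1) - \<delta>t * \<delta>x * nx k i) * q k (i + 1))
        = grid_sum (\<lambda>k i. q k (i + 1) * l k (i + 1) - (\<delta>t * \<delta>x) * (q k (i + 1) * nx k i))"
      by (simp add: algebra_simps)
    also have "\<dots> = grid_sum (\<lambda>k i. q k (i + 1) * l k (i + 1)) - \<delta>t * \<delta>x * grid_sum (\<lambda>k i. q k (i + 1) * nx k i)"
      by (subst grid_sum_diff) (intro fs, intro fs, simp only: grid_sum_cmult)
    also have "grid_sum (\<lambda>k i. q k (i + 1) * l k (i + 1)) = grid_sum (\<lambda>k i. q k i * l k i)"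
      by (rule grid_sum_shift_space(2)[of "\<lambda>k i. q k i * l k i"])
    finally show ?thesis .
  qed
  have T4: "grid_sum (\<lambda>k i. q k (i + 1) * (n k (i + 1) - n k i - \<delta>x * nx k i))
      = grid_sum (\<lambda>k i. q k i * n k i) - grid_sum (\<lambda>k i. q k (i + 1) * n k i) - \<delta>x * grid_sum (\<lambda>k i. q k (i + 1) * nx k i)"
  proof -
    have "grid_sum (\<lambda>k i. q k (i + 1) * (n k (i + 1) - n k i - \<delta>x * nx k i))
        = grid_sum (\<lambda>k i. q k (i + 1) * n k (i + 1) - q k (i + 1) * n k i - \<delta>x * (q k (i + 1) * nx k i))"
      by (simp only: right_diff_distrib mult.left_commute)
    also have "\<dots> = grid_sum (\<lambda>k i. q k (i + 1) * n k (i + 1) - q k (i + 1) * n k i)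
        - \<delta>x * grid_sum (\<lambda>k i. q k (i + 1) * nx k i)"
      by (subst grid_sum_diff) (intro fs, intro fs, simp only: grid_sum_cmult)
    also have "grid_sum (\<lambda>k i. q k (i + 1) * n k (i + 1) - q k (i + 1) * n k i)
        = grid_sum (\<lambda>k i. q k (i + 1) * n k (i + 1)) - grid_sum (\<lambda>k i. q k (i + 1) * n k i)"
      by (rule grid_sum_diff) (intro fs)+
    also have "grid_sum (\<lambda>k i. q k (i + 1) * n k (i + 1)) = grid_sum (\<lambda>k i. q k i * n k i)"
      by (rule grid_sum_shift_space(2)[of "\<lambda>k i. q k i * n k i"])
    finally show ?thesis .
  qed
  have M: "(LINT t:{0..}|lebesgue. LINT x|lebesgue.
       \<phi> t x * \<beta> (w_grid \<kappa> h \<delta>x \<delta>t \<rho>0 t x) - D_x \<phi> t x * Q' \<kappa> (\<rho>_grid \<kappa> h \<delta>x \<delta>t \<rho>0 t x))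
     = grid_sum (\<lambda>k i. b k i * J\<^sub>0 k i) - grid_sum (\<lambda>k i. q k i * Jx k i)"
  proof -
    have "grid_sum (\<lambda>k i. b k i * J\<^sub>0 k i - q k i * Jx k i) = grid_sum (\<lambda>k i. b k i * J\<^sub>0 k i) - grid_sum (\<lambda>k i. q k i * Jx k i)"
      by (rule grid_sum_diff) (intro fs)+
    then show ?thesis unfolding velocity_main_part[OF \<beta>] defs .
  qed
  have P: "P2 \<kappa> h \<beta> \<delta>x \<delta>t \<rho>0 \<phi> = - grid_sum (\<lambda>k i. (Jx k i - l k i) * q k i)
    + grid_sum (\<lambda>k i. (J\<^sub>0 k i - \<delta>t * \<delta>x * n k i) * b k i)
    - grid_sum (\<lambda>k i. (l k (i + 1) - \<delta>t * \<delta>x * nx k i) * q k (i + 1))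
    + \<delta>t * grid_sum (\<lambda>k i. q k (i + 1) * (n k (i + 1) - n k i - \<delta>x * nx k i))"
    unfolding P2_eq defs ..
  show ?thesis
    unfolding M P T1 T2 T3 T4 by (simp add: algebra_simps)
qed

end

section \<open>Suprema, mean values and convergent sums\<close>

lemma linf_norm_nonneg_and_AE:
  assumes "in_Linf f"
  shows "linf_norm f \<ge> 0" "AE x in lebesgue. \<bar>f x\<bar> \<le> linf_norm f"
proof -
  let ?E = "esssup lebesgue (\<lambda>x. ereal \<bar>f x\<bar>)"
  have m: "(\<lambda>x. ereal \<bar>f x\<bar>) \<in> borel_measurable lebesgue" using assms unfolding in_Linf_def
    by (intro borel_measurable_ereal borel_measurable_abs) simp
  have "esssup lebesgue (\<lambda>x :: real. 0 :: ereal) \<le> ?E" by (intro esssup_mono) auto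
  then have "?E \<ge> 0" by (simp add: esssup_const)
  moreover have "?E < \<infinity>" using assms by (simp add: in_Linf_def)
  ultimately have E: "?E = ereal (linf_norm f)" and nn: "linf_norm f \<ge> 0"
    by (auto simp: linf_norm_def ereal_real real_of_ereal_pos)
  show "linf_norm f \<ge> 0" by (rule nn)
  show "AE x in lebesgue. \<bar>f x\<bar> \<le> linf_norm f"
    using esssup_AE[of "\<lambda>x. ereal \<bar>f x\<bar>" lebesgue] unfolding E by simp
qed

lemma linf_norm_le:
  assumes "in_Linf f" "\<And>x. \<bar>f x\<bar> \<le> c"
  shows "linf_norm f \<le> c"
proof -
  have "esssup lebesgue (\<lambda>x. ereal \<bar>f x\<bar>) \<le> ereal c"
    by (rule esssup_I) (use assms in \<open>auto simp: in_Linf_def\<close>)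
  moreover have "0 \<le> c" using assms(2)[of 0] by linarith
  ultimately show ?thesis
    unfolding linf_norm_def by (cases "esssup lebesgue (\<lambda>x. ereal \<bar>f x\<bar>)") auto
qed

text \<open>A nonempty open set is not negligible, so for continuous functions the essential supremum
  bounds every value.\<close>
lemma continuous_le_linf_norm:
  assumes "continuous_on UNIV f" "in_Linf f"
  shows "\<bar>f x\<bar> \<le> linf_norm f"
proof (rule ccontr)
  assume "\<not> \<bar>f x\<bar> \<le> linf_norm f"
  then have ne: "{x. \<bar>f x\<bar> > linf_norm f} \<noteq> {}" by (auto simp: not_le)
  have "open {x. \<bar>f x\<bar> > linf_norm f}"
    using assms(1) by (intro open_Collect_less continuous_intros) auto
  have "{x. \<bar>f x\<bar> > linf_norm f} \<in> sets lebesgue"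
    using borel_open[OF \<open>open _\<close>] by (intro sets_completionI_sets) simp
  note lmeasurable_S = this
  from \<open>open _\<close> have "{x. \<bar>f x\<bar> > linf_norm f} \<notin> null_sets lebesgue"
    using open_not_negligible[OF _ ne] by (simp add: negligible_iff_null_sets)
  moreover have "{x. \<bar>f x\<bar> > linf_norm f} \<in> null_sets lebesgue"
    using linf_norm_nonneg_and_AE(2)[OF assms(2)] lmeasurable_S
    by (simp add: AE_iff_null_sets not_less)
  ultimately show False by blast
qed

lemma mvt_halfopen:
  assumes "\<And>x. x \<in> {0..<R} \<Longrightarrow> (f has_real_derivative f' x) (at x within {0..<R})"
    "a \<in> {0..<R}" "b \<in> {0..<R}"
  shows "\<exists>z\<in>{min a b..max a b}. f b - f a = f' z * (b - a)"
proof -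
  have *: "\<exists>z\<in>{a..b}. f b - f a = f' z * (b - a)" if "a \<le> b" "a \<in> {0..<R}" "b \<in> {0..<R}" for a b
  proof (rule mvt_very_simple[OF that(1)])
    fix x assume "a \<le> x" "x \<le> b"
    then have "x \<in> {0..<R}" "{a..b} \<subseteq> {0..<R}" using that by auto
    then show "(f has_derivative (*) (f' x)) (at x within {a..b})"
      using has_field_derivative_subset[OF assms(1)] unfolding has_field_derivative_def by blast
  qed
  show ?thesis
  proof (cases "a \<le> b")
    case True then show ?thesis using *[of a b] assms by simp
  next
    case False
    then obtain z where "z \<in> {b..a}" "f a - f b = f' z * (a - b)" using *[of b a] assms by auto
    then show ?thesis using False by (intro bexI[of _ z]) (auto simp: algebra_simps)
  qed
qed

lemma has_real_derivative_Q':
  assumes "R > 1" "continuous_on {0..<R} \<kappa>" "\<rho> \<in> {0..<R}"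
  shows "(Q' \<kappa> has_real_derivative \<kappa> \<rho>) (at \<rho> within {0..<R})"
proof -
  define c where "c = (max 1 \<rho> + R) / 2"
  have c: "1 < c" "\<rho> < c" "c < R" using assms by (auto simp: c_def max_def)
  have ck: "continuous_on {0..c} \<kappa>" using assms(2) by (rule continuous_on_subset) (use c in auto)
  have "(Q' \<kappa> has_real_derivative \<kappa> \<rho>) (at \<rho> within {0..c})"
    using interval_integral_FTC2[of 0 1 c \<kappa> \<rho>] c assms ck
    by (auto simp: has_real_derivative_iff_has_vector_derivative one_ereal_def Q'_def[abs_def])
  moreover have "at \<rho> within {0..c} = at \<rho> within {0..<R}"
    by (rule at_within_nhd[of _ "{..<c}"]) (use c in auto)
  ultimately show ?thesis by simp
qed

lemma summable_on_mult_bounded: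
  fixes u y :: "int \<Rightarrow> real"
  assumes "u summable_on UNIV" "\<And>i. u i \<ge> 0" "\<And>i. \<bar>y i\<bar> \<le> C"
  shows "(\<lambda>i. u i * y i) summable_on UNIV"
proof (rule abs_summable_summable, rule summable_on_comparison_test)
  show "(\<lambda>i. C * u i) summable_on UNIV" using assms(1) by (rule summable_on_cmult_right)
  show "norm (u i * y i) \<le> C * u i" for i
    using mult_right_mono[OF assms(3)[of i] assms(2)[of i]] assms(2)[of i] by (simp add: abs_mult mult.commute)
  show "0 \<le> norm (u i * y i)" for i by simp
qed

lemma summable_on_int_shift:
  fixes f :: "int \<Rightarrow> real"
  assumes "f summable_on UNIV"
  shows "(\<lambda>i. f (i + j)) summable_on UNIV"
proof -
  have "bij_betw (\<lambda>i. i + j) UNIV UNIV" by (rule bij_betwI[of _ _ _ "\<lambda>i. i - j"]) auto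
  from summable_on_reindex_bij_betw[OF this, of f] assms show ?thesis by simp
qed

text \<open>Conservation form: differences of a summable flux do not change the total.\<close>
lemma infsum_add_flux_difference:
  fixes u c :: "int \<Rightarrow> real"
  assumes "u summable_on UNIV" "c summable_on UNIV"
  shows "(\<lambda>i. u i + (c (i - 1) - c i)) summable_on UNIV"
    "(\<Sum>\<^sub>\<infinity>i. u i + (c (i - 1) - c i)) = infsum u UNIV"
proof -
  have s: "(\<lambda>i. c (i - 1)) summable_on UNIV" using summable_on_int_shift[OF assms(2), of "-1"] by simp
  have s': "(\<lambda>i. - c i) summable_on UNIV" using assms(2) by (simp add: summable_on_uminus)
  have d: "(\<lambda>i. c (i - 1) - c i) summable_on UNIV"
    using summable_on_add[OF s s'] by simp
  show "(\<lambda>i. u i + (c (i - 1) - c i)) summable_on UNIV"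
    by (rule summable_on_add[OF assms(1) d])
  have "(\<Sum>\<^sub>\<infinity>i. c (i - 1) - c i) = 0"
    using infsum_add[OF s s'] infsum_int_shift[of c "-1"] by (simp add: infsum_uminus)
  then show "(\<Sum>\<^sub>\<infinity>i. u i + (c (i - 1) - c i)) = infsum u UNIV"
    using infsum_add[OF assms(1) d] by simp
qed

text \<open>One step for a cell \<open>rc\<close> with neighbours \<open>rl\<close>, \<open>rr\<close>; \<open>wl\<close> and \<open>wr\<close> are the velocities across its left and
  right side. Up to the factor \<open>l\<close>, the cell can lose at most \<open>rc (b + M C)\<close>, where \<open>M C\<close> accounts for a backward flow
  through the left side, and can gain at most \<open>(M - rc) (b + 2 M C)\<close>: inflow from the left requires
  \<open>rl > rc\<close>, backward inflow from the right requires \<open>rr > rc\<close>, and \<open>rl\<close>, \<open>rr\<close> do not exceed \<open>M\<close>.\<close>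
lemma step_maximum_principle:
  fixes M C b l rl rc rr wl wr :: real
  assumes r: "rl \<in> {0..M}" "rc \<in> {0..M}" "rr \<in> {0..M}" and nn: "C \<ge> 0" "b \<ge> 0" "l \<ge> 0"
    and cfl: "l * (b + 2 * (M * C)) \<le> 1"
    and b: "wl \<le> b" "wr \<le> b"
    and wl: "rl \<ge> rc \<Longrightarrow> 0 \<le> wl \<and> wl \<le> C * (rl - rc)" "rl \<le> rc \<Longrightarrow> - (C * (rc - rl)) \<le> wl \<and> wl \<le> 0"
    and wr: "rc \<ge> rr \<Longrightarrow> 0 \<le> wr" "rc \<le> rr \<Longrightarrow> - (C * (rr - rc)) \<le> wr"
  shows "rc + l * (rl * wl - rc * wr) \<in> {0..M}"
proof -
  have M: "M \<ge> 0" "M * C \<ge> 0" using r nn by auto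
  have lo1: "rl * wl \<ge> - (rc * (M * C))"
  proof (cases "rl \<ge> rc")
    case True
    then have "rl * wl \<ge> 0" using wl(1) r by simp
    moreover have "rc * (M * C) \<ge> 0" using r M by simp
    ultimately show ?thesis by linarith
  next
    case False
    have "rl * (C * (rc - rl)) \<le> M * (C * rc)"
      using r nn False by (intro mult_mono) auto
    moreover have "rl * wl \<ge> rl * (- (C * (rc - rl)))"
      using wl(2) False r by (intro mult_left_mono) auto
    ultimately show ?thesis by (simp add: algebra_simps)
  qed
  have lo2: "rc * wr \<le> rc * b" using r b by (intro mult_left_mono) auto
  have "- (rc * (b + 2 * (M * C))) \<le> rl * wl - rc * wr"
  proof -
    have "rc * (M * C) \<ge> 0" using r M by simp
    then show ?thesis using lo1 lo2 by (simp add: algebra_simps)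
  qed
  then have "l * (- (rc * (b + 2 * (M * C)))) \<le> l * (rl * wl - rc * wr)" using nn by (intro mult_left_mono) auto
  moreover have "rc * (l * (b + 2 * (M * C))) \<le> rc * 1" using cfl r by (intro mult_left_mono) auto
  ultimately have lo: "rc + l * (rl * wl - rc * wr) \<ge> 0" by (simp add: algebra_simps)
  have up1: "rl * wl \<le> (M - rc) * b + (M - rc) * (M * C)"
  proof (cases "rl \<le> rc")
    case True
    then have "rl * wl \<le> 0" using wl(2) r by (simp add: mult_nonneg_nonpos)
    moreover have "(M - rc) * b \<ge> 0" "(M - rc) * (M * C) \<ge> 0" using r M nn by auto
    ultimately show ?thesis by linarith
  next
    case False
    then have w: "0 \<le> wl" "wl \<le> C * (rl - rc)" using wl(1) by auto
    have "(rl - rc) * wl \<le> (M - rc) * b" using w r b False by (intro mult_mono) auto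
    moreover have "rc * wl \<le> M * (C * (M - rc))"
    proof (intro mult_mono)
      show "wl \<le> C * (M - rc)" using w(2) r nn by (meson atLeastAtMost_iff diff_right_mono mult_left_mono order_trans)
    qed (use r w M in auto)
    ultimately show ?thesis by (simp add: algebra_simps)
  qed
  have up2: "- (rc * wr) \<le> (M - rc) * (M * C)"
  proof (cases "rc \<ge> rr")
    case True
    then have "rc * wr \<ge> 0" using wr(1) r by simp
    moreover have "(M - rc) * (M * C) \<ge> 0" using r M nn by auto
    ultimately show ?thesis by linarith
  next
    case False
    then have "- wr \<le> C * (rr - rc)" using wr(2) by linarith
    also have "\<dots> \<le> C * (M - rc)" using r nn by (intro mult_left_mono) auto
    finally have "rc * (- wr) \<le> rc * (C * (M - rc))" using r by (intro mult_left_mono) auto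
    also have "\<dots> \<le> M * (C * (M - rc))" using r nn by (intro mult_right_mono) auto
    finally show ?thesis by (simp add: algebra_simps)
  qed
  have "l * (rl * wl - rc * wr) \<le> l * ((M - rc) * (b + 2 * (M * C)))"
    using nn up1 up2 by (intro mult_left_mono) (auto simp: algebra_simps)
  also have "\<dots> = (M - rc) * (l * (b + 2 * (M * C)))" by simp
  also have "\<dots> \<le> (M - rc) * 1" using cfl r by (intro mult_left_mono) auto
  finally have "rc + l * (rl * wl - rc * wr) \<le> M" by simp
  with lo show ?thesis by simp
qed

section \<open>Conservation, maximum principle and entropy\<close>

locale traffic_scheme =
  fixes R b \<delta>x \<delta>t :: real and \<kappa> h \<rho>0 :: "real \<Rightarrow> real"
  assumes R: "R > 1" and b: "b > 0"
    and \<kappa>_C1: "C1_on \<kappa> {0..<R}" and \<kappa>_nonneg: "\<And>\<rho>. \<rho> \<in> {0..<R} \<Longrightarrow> \<kappa> \<rho> \<ge> 0"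
    and \<kappa>_zero: "\<And>\<rho>. \<rho> \<in> {0..1} \<Longrightarrow> \<kappa> \<rho> = 0"
    and h_C1: "C1_on h UNIV" and h_range: "range h = {-1<..<b}" and h_Linf: "in_Linf (deriv h)"
    and h0: "h 0 = 0" and h_deriv_pos: "\<And>s. deriv h s > 0"
    and \<rho>0: "\<rho>0 \<in> X_space R" and dx: "\<delta>x > 0" and dt: "\<delta>t > 0"
begin

abbreviation r where "r \<equiv> \<rho>_seq \<kappa> h \<delta>x \<delta>t \<rho>0"
abbreviation w where "w \<equiv> w_seq \<kappa> h \<delta>x \<delta>t \<rho>0"
abbreviation M where "M \<equiv> linf_norm \<rho>0"
abbreviation H where "H \<equiv> linf_norm (deriv h)"
abbreviation K where "K \<equiv> (SUP \<rho>\<in>{0..M}. \<kappa> \<rho>)"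

lemma \<rho>0_integrable: "integrable lebesgue \<rho>0" and \<rho>0_Linf: "in_Linf \<rho>0"
  using \<rho>0 by (auto simp: X_space_def)

lemma \<rho>0_nonneg: "\<rho>0 x \<ge> 0"
  using \<rho>0 cINF_lower[of \<rho>0 UNIV x] by (auto simp: X_space_def)

lemma \<rho>0_bound: "\<exists>c<R. \<forall>x. \<rho>0 x \<le> c"
  using \<rho>0 cSUP_upper[of _ UNIV \<rho>0] by (intro exI[of _ "SUP x. \<rho>0 x"]) (auto simp: X_space_def)

lemma M_nonneg: "M \<ge> 0" and \<rho>0_le_M: "AE x in lebesgue. \<rho>0 x \<le> M"
  using linf_norm_nonneg_and_AE[OF \<rho>0_Linf] by auto

lemma M_less_R: "M < R"
proof -
  obtain c where "c < R" "\<And>x. \<rho>0 x \<le> c" using \<rho>0_bound by blast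
  then show ?thesis using linf_norm_le[OF \<rho>0_Linf, of c] \<rho>0_nonneg by fastforce
qed

lemma rec: "r (Suc k) i = r k i + \<delta>t / \<delta>x * (r k (i - 1) * w k (i - 1) - r k i * w k i)"
  by (simp add: w_seq_def Let_def \<rho>_seq.simps)

lemma h_DERIV: "DERIV h x :> deriv h x" and h_deriv_cont: "continuous_on UNIV (deriv h)"
proof -
  obtain h' where h': "\<And>x. DERIV h x :> h' x" "continuous_on UNIV h'"
    using h_C1 by (auto simp: C1_on_def)
  have "deriv h = h'" using DERIV_imp_deriv[OF h'(1)] by blast
  then show "DERIV h x :> deriv h x" "continuous_on UNIV (deriv h)" using h' by simp_all
qed

lemma h_mvt: "\<exists>z. h s = s * deriv h z"
proof -
  note D = h_DERIV
  consider "s = 0" | "s > 0" | "s < 0" by linarith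
  then show ?thesis
  proof cases
    case 2 then show ?thesis using MVT2[of 0 s h "deriv h"] D h0 by auto
  next
    case 3 then show ?thesis using MVT2[of s 0 h "deriv h"] D h0 by force
  qed (use h0 in auto)
qed

lemma deriv_h_le: "deriv h s \<le> H"
  using continuous_le_linf_norm[OF h_deriv_cont h_Linf, of s] by linarith

lemma H_nonneg: "H \<ge> 0" using deriv_h_le[of 0] h_deriv_pos[of 0] by linarith

text \<open>All from \<open>h(s) = s h'(z)\<close> with \<open>0 < h'(z) \<le> H\<close>.\<close>
lemma h_bounds: "0 \<le> s \<Longrightarrow> 0 \<le> h s \<and> h s \<le> H * s" "s \<le> 0 \<Longrightarrow> H * s \<le> h s \<and> h s \<le> 0" "(h s)\<^sup>2 \<le> H * (s * h s)" "0 \<le> s * h s"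
proof -
  obtain z where z: "h s = s * deriv h z" using h_mvt by blast
  note p = h_deriv_pos[of z] deriv_h_le[of z]
  show "0 \<le> h s \<and> h s \<le> H * s" if "0 \<le> s"
    using that p mult_left_mono[OF p(2) that] by (simp add: z mult.commute)
  show "H * s \<le> h s \<and> h s \<le> 0" if "s \<le> 0"
    using that p mult_left_mono_neg[OF p(2) that] by (simp add: z mult.commute mult_nonpos_nonneg)
  show nn: "0 \<le> s * h s" using p(1) by (simp add: z flip: mult.assoc)
  have "(h s)\<^sup>2 = deriv h z * (s * h s)" by (simp add: z power2_eq_square)
  also have "\<dots> \<le> H * (s * h s)" using p(2) nn by (rule mult_right_mono)
  finally show "(h s)\<^sup>2 \<le> H * (s * h s)" .
qed

lemma w_bounds: "w k i \<le> b" "\<bar>w k i\<bar> \<le> 1 + b"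
proof -
  have "w k i \<in> range h" by (simp add: w_seq_def)
  then show "w k i \<le> b" "\<bar>w k i\<bar> \<le> 1 + b" using b unfolding h_range by auto
qed

lemma \<kappa>_cont: "continuous_on {0..<R} \<kappa>"
  using \<kappa>_C1 unfolding C1_on_def by (blast intro: DERIV_continuous_on)

lemma \<kappa>_le_K: "z \<in> {0..M} \<Longrightarrow> \<kappa> z \<le> K"
proof (rule cSUP_upper)
  have "continuous_on {0..M} \<kappa>" by (rule continuous_on_subset[OF \<kappa>_cont]) (use M_less_R in auto)
  then have "compact (\<kappa> ` {0..M})" by (intro compact_continuous_image) auto
  then show "bdd_above (\<kappa> ` {0..M})" by (intro bounded_imp_bdd_above compact_imp_bounded)
qed

lemma K_nonneg: "K \<ge> 0"
  using \<kappa>_le_K[of 0] \<kappa>_nonneg[of 0] M_nonneg R by auto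

lemma Q'_mvt: "x \<in> {0..<R} \<Longrightarrow> y \<in> {0..<R} \<Longrightarrow> \<exists>z\<in>{min x y..max x y}. Q' \<kappa> y - Q' \<kappa> x = \<kappa> z * (y - x)"
  by (rule mvt_halfopen[OF has_real_derivative_Q'[OF R \<kappa>_cont]])

lemma Q_mvt: "x \<in> {0..<R} \<Longrightarrow> y \<in> {0..<R} \<Longrightarrow> \<exists>z\<in>{min x y..max x y}. Q \<kappa> y - Q \<kappa> x = Q' \<kappa> z * (y - x)"
  by (rule mvt_halfopen[OF has_real_derivative_Q[OF R \<kappa>_cont]])

lemma Q'_mono:
  assumes "0 \<le> x" "x \<le> y" "y < R"
  shows "Q' \<kappa> x \<le> Q' \<kappa> y"
proof -
  obtain z where z: "z \<in> {x..y}" "Q' \<kappa> y - Q' \<kappa> x = \<kappa> z * (y - x)"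
    using Q'_mvt[of x y] assms by (auto simp: min_absorb1 max_absorb2)
  have "\<kappa> z * (y - x) \<ge> 0" using z(1) assms by (intro mult_nonneg_nonneg \<kappa>_nonneg) auto
  then show ?thesis using z(2) by linarith
qed

lemma Q'_lipschitz:
  assumes "0 \<le> x" "x \<le> y" "y \<le> M"
  shows "Q' \<kappa> y - Q' \<kappa> x \<le> K * (y - x)"
proof -
  obtain z where z: "z \<in> {x..y}" "Q' \<kappa> y - Q' \<kappa> x = \<kappa> z * (y - x)"
    using Q'_mvt[of x y] assms M_less_R by (auto simp: min_absorb1 max_absorb2)
  show ?thesis unfolding z(2) using \<kappa>_le_K[of z] z(1) assms by (intro mult_right_mono) auto
qed

lemma Q'_zero: "x \<in> {0..1} \<Longrightarrow> Q' \<kappa> x = 0"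
proof -
  assume x: "x \<in> {0..1}"
  have "Q' \<kappa> 1 = 0" by (simp add: Q'_def one_ereal_def)
  moreover obtain z where "z \<in> {x..1}" "Q' \<kappa> 1 - Q' \<kappa> x = \<kappa> z * (1 - x)"
    using Q'_mvt[of x 1] x R by (auto simp: min_absorb1 max_absorb2)
  ultimately show ?thesis using \<kappa>_zero[of z] x by simp
qed

lemma Q'_nonneg: "x \<in> {0..<R} \<Longrightarrow> Q' \<kappa> x \<ge> 0"
  using Q'_mono[of 0 x] Q'_zero[of 0] by simp

text \<open>Convexity of \<open>Q\<close>: the graph lies above its tangent at \<open>y\<close>.\<close>
lemma Q_tangent:
  assumes "x \<in> {0..<R}" "y \<in> {0..<R}"
  shows "Q \<kappa> y - Q \<kappa> x \<le> Q' \<kappa> y * (y - x)"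
proof -
  obtain z where z: "z \<in> {min x y..max x y}" "Q \<kappa> y - Q \<kappa> x = Q' \<kappa> z * (y - x)"
    using Q_mvt[OF assms] by blast
  show ?thesis
  proof (cases "x \<le> y")
    case True
    then show ?thesis unfolding z(2) using z(1) assms by (intro mult_right_mono Q'_mono) auto
  next
    case False
    then show ?thesis unfolding z(2) using z(1) assms by (intro mult_right_mono_neg Q'_mono) auto
  qed
qed

lemma Q_nonneg_le:
  assumes "x \<in> {0..<R}"
  shows "0 \<le> Q \<kappa> x" "Q \<kappa> x \<le> Q' \<kappa> x * x"
proof -
  have Q0: "Q \<kappa> 0 = 0"
  proof -
    obtain z where "z \<in> {0..1}" "Q \<kappa> 1 - Q \<kappa> 0 = Q' \<kappa> z * (1 - 0)" using Q_mvt[of 0 1] R by auto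
    moreover have "Q \<kappa> 1 = 0" by (simp add: Q_def one_ereal_def)
    ultimately show ?thesis using Q'_zero by simp
  qed
  show "0 \<le> Q \<kappa> x" using Q_tangent[of x 0] Q'_zero[of 0] Q0 assms R by simp
  show "Q \<kappa> x \<le> Q' \<kappa> x * x" using Q_tangent[of 0 x] Q0 assms R by simp
qed

lemma initial_bounds: "r 0 i \<in> {0..M}"
proof -
  have si: "set_integrable lebesgue (cell \<delta>x i) \<rho>0" by (rule set_integrable_cell[OF \<rho>0_integrable])
  have "(LINT x:cell \<delta>x i|lebesgue. \<rho>0 x) \<le> (LINT x:cell \<delta>x i|lebesgue. M)"
  proof (rule set_integral_mono_AE[OF si integral_const_cell(1)[OF dx]])
    show "AE x \<in> cell \<delta>x i in lebesgue. \<rho>0 x \<le> M" using \<rho>0_le_M by eventually_elim simp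
  qed
  also have "\<dots> = \<delta>x * M" by (rule integral_const_cell(2)[OF dx])
  finally have "(LINT x:cell \<delta>x i|lebesgue. \<rho>0 x) \<le> \<delta>x * M" .
  moreover have "(LINT x:cell \<delta>x i|lebesgue. \<rho>0 x) \<ge> 0"
    by (rule set_integral_nonneg_real) (rule \<rho>0_nonneg)
  ultimately show ?thesis using dx by (simp add: \<rho>_seq.simps divide_simps mult.commute)
qed

lemma mass_initial: "(r 0 has_sum (LINT x|lebesgue. \<rho>0 x) / \<delta>x) UNIV"
  using has_sum_cmult_right[OF has_sum_integral_cells[OF dx \<rho>0_integrable \<rho>0_nonneg], of "1 / \<delta>x"]
  by (simp add: \<rho>_seq.simps)

text \<open>The first part comes from summing \<open>Q'(\<rho>\<^sub>i) (f\<^sub>i\<^sub>-\<^sub>1 - f\<^sub>i)\<close> by parts for the mass flux \<open>f = \<rho> w\<close>, the second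
  from the neighbour's share in \<open>(f\<^sub>i\<^sub>-\<^sub>1 - f\<^sub>i)\<^sup>2 \<le> 2 f\<^sub>i\<^sub>-\<^sub>1\<^sup>2 + 2 f\<^sub>i\<^sup>2\<close>. The factor \<open>\<rho>\<^sub>i\<close> makes it summable.\<close>
definition entropy_flux :: "nat \<Rightarrow> int \<Rightarrow> real" where
  "entropy_flux k i = r k i *
     (\<delta>t / \<delta>x * Q' \<kappa> (r k (i + 1)) * w k i + 2 * K * (\<delta>t / \<delta>x)\<^sup>2 * r k i * (w k i)\<^sup>2)"

context
  assumes wd: "well_defined R \<kappa> h \<delta>x \<delta>t \<rho>0"
begin

lemma r_range: "r k i \<in> {0..<R}" using wd by (simp add: well_defined_def)

lemma r_nonneg: "r k i \<ge> 0" using r_range[of k i] by simp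

lemma mass_discrete: "(r k has_sum (LINT x|lebesgue. \<rho>0 x) / \<delta>x) UNIV"
proof (induction k)
  case 0 show ?case by (rule mass_initial)
next
  case (Suc k)
  let ?c = "\<lambda>i. \<delta>t / \<delta>x * (r k i * w k i)"
  have s: "r k summable_on UNIV" using Suc by (simp add: summable_on_def) blast
  have c: "?c summable_on UNIV"
    by (intro summable_on_cmult_right summable_on_mult_bounded[OF s r_nonneg w_bounds(2)])
  have e: "r (Suc k) = (\<lambda>i. r k i + (?c (i - 1) - ?c i))" by (simp add: rec fun_eq_iff algebra_simps)
  have "(r (Suc k) has_sum infsum (r (Suc k)) UNIV) UNIV"
    unfolding e by (rule has_sum_infsum[OF infsum_add_flux_difference(1)[OF s c]])
  also have "infsum (r (Suc k)) UNIV = infsum (r k) UNIV"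
    unfolding e by (rule infsum_add_flux_difference(2)[OF s c])
  also have "\<dots> = (LINT x|lebesgue. \<rho>0 x) / \<delta>x" by (rule infsumI[OF Suc])
  finally show ?case .
qed

lemma r_summable: "r k summable_on UNIV"
  using mass_discrete[of k] by (auto simp: summable_on_def)

lemma mass_conservation:
  shows "integrable lebesgue (\<rho>_grid \<kappa> h \<delta>x \<delta>t \<rho>0 t)"
    "(LINT x|lebesgue. \<rho>_grid \<kappa> h \<delta>x \<delta>t \<rho>0 t x) = (LINT x|lebesgue. \<rho>0 x)"
proof -
  define k where "k = nat \<lfloor>t / \<delta>t\<rfloor>"
  have e: "\<rho>_grid \<kappa> h \<delta>x \<delta>t \<rho>0 t = (\<lambda>x. r k \<lfloor>x / \<delta>x\<rfloor>)"
    by (simp add: fun_eq_iff \<rho>_grid_def grid_fun_def k_def)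
  show "integrable lebesgue (\<rho>_grid \<kappa> h \<delta>x \<delta>t \<rho>0 t)"
    unfolding e by (rule integral_step_function(1)[OF dx r_summable r_nonneg])
  show "(LINT x|lebesgue. \<rho>_grid \<kappa> h \<delta>x \<delta>t \<rho>0 t x) = (LINT x|lebesgue. \<rho>0 x)"
    using integral_step_function(2)[OF dx r_summable r_nonneg, of k] infsumI[OF mass_discrete[of k]] dx
    by (simp add: e)
qed

lemma r_tendsto_zero: "(\<lambda>n. r k (int n)) \<longlonglongrightarrow> 0"
proof -
  have "r k summable_on range int" by (rule summable_on_subset_banach[OF r_summable]) simp
  then have "(\<lambda>n. r k (int n)) summable_on UNIV"
    by (subst (asm) summable_on_reindex) (simp_all add: o_def)
  then have "summable (\<lambda>n. r k (int n))"
    using has_sum_imp_sums[OF has_sum_infsum] by (auto simp: summable_def)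
  then show ?thesis by (rule summable_LIMSEQ_zero)
qed

end

context
  assumes cfl1: "1 \<ge> \<delta>t / \<delta>x * (b + 2 * (M * H / \<delta>x) * K)"
    and cfl2: "1 \<ge> \<delta>t * (4 * M * H / \<delta>x\<^sup>2) * K"
begin

text \<open>Monotonicity and the Lipschitz bound of \<open>Q'\<close> on \<open>[0, M]\<close> turn differences of densities into the
  velocity bounds that one step requires, with \<open>C = H K / \<delta>x\<close>. The induction hypothesis keeps all
  arguments of \<open>Q'\<close> in \<open>[0, M]\<close>.\<close>
lemma maximum_principle: "r k i \<in> {0..M}"
proof (induction k arbitrary: i)
  case 0 show ?case by (rule initial_bounds)
next
  case (Suc k)
  let ?C = "H * K / \<delta>x"
  have up: "w k i \<le> ?C * (r k i - r k (i + 1))" "0 \<le> w k i" if "r k i \<ge> r k (i + 1)" for i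
  proof -
    define s where "s = (Q' \<kappa> (r k i) - Q' \<kappa> (r k (i + 1))) / \<delta>x"
    have s: "0 \<le> s" "s \<le> K * (r k i - r k (i + 1)) / \<delta>x"
      using that Suc[of i] Suc[of "i + 1"] dx M_less_R Q'_mono[of "r k (i + 1)" "r k i"]
        Q'_lipschitz[of "r k (i + 1)" "r k i"] by (auto simp: s_def divide_right_mono)
    have w: "w k i = h s" by (simp add: w_seq_def s_def)
    show "0 \<le> w k i" using h_bounds(1)[OF s(1)] w by simp
    have "w k i \<le> H * s" using h_bounds(1)[OF s(1)] w by simp
    also have "\<dots> \<le> H * (K * (r k i - r k (i + 1)) / \<delta>x)" using s(2) H_nonneg by (rule mult_left_mono)
    finally show "w k i \<le> ?C * (r k i - r k (i + 1))" by simp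
  qed
  have lo: "- (?C * (r k (i + 1) - r k i)) \<le> w k i" "w k i \<le> 0" if "r k i \<le> r k (i + 1)" for i
  proof -
    define s where "s = (Q' \<kappa> (r k i) - Q' \<kappa> (r k (i + 1))) / \<delta>x"
    have "- (K * (r k (i + 1) - r k i)) / \<delta>x \<le> s"
      unfolding s_def using that Suc[of i] Suc[of "i + 1"] dx Q'_lipschitz[of "r k i" "r k (i + 1)"]
      by (intro divide_right_mono) auto
    then have s: "- (K * (r k (i + 1) - r k i) / \<delta>x) \<le> s" "s \<le> 0"
      using that Suc[of i] Suc[of "i + 1"] dx M_less_R Q'_mono[of "r k i" "r k (i + 1)"]
      by (auto simp: s_def divide_le_0_iff)
    have w: "w k i = h s" by (simp add: w_seq_def s_def)
    show "w k i \<le> 0" using h_bounds(2)[OF s(2)] w by simp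
    have "- (?C * (r k (i + 1) - r k i)) = H * (- (K * (r k (i + 1) - r k i) / \<delta>x))" by simp
    also have "\<dots> \<le> H * s" using s(1) H_nonneg by (rule mult_left_mono)
    also have "\<dots> \<le> w k i" using h_bounds(2)[OF s(2)] w by simp
    finally show "- (?C * (r k (i + 1) - r k i)) \<le> w k i" .
  qed
  show ?case
    unfolding rec
  proof (rule step_maximum_principle[where C = ?C and b = b and rr = "r k (i + 1)"])
    show "\<delta>t / \<delta>x * (b + 2 * (M * ?C)) \<le> 1" using cfl1 by (simp add: mult_ac)
  qed (use Suc H_nonneg K_nonneg b dx dt w_bounds up lo up[of "i - 1"] lo[of "i - 1"] in auto)
qed

lemma well_defined_of_CFL: "well_defined R \<kappa> h \<delta>x \<delta>t \<rho>0"
  unfolding well_defined_def using order_le_less_trans[OF _ M_less_R] maximum_principle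
  by (meson atLeastAtMost_iff atLeastLessThan_iff)

text \<open>A local inequality in conservation form. Expanding around the new value gives the linear term
  and a square; what does not fit into the flux difference is
  \<open>- \<delta>t \<rho>\<^sub>i v h(v) + 4 K (\<delta>t / \<delta>x)\<^sup>2 (\<rho>\<^sub>i h(v))\<^sup>2\<close>, which is nonpositive by \<open>h(v)\<^sup>2 \<le> H v h(v)\<close>, \<open>\<rho>\<^sub>i \<le> M\<close> and the
  second step size condition.\<close>
lemma discrete_entropy_inequality:
  "Q \<kappa> (r (Suc k) i) \<le> Q \<kappa> (r k i) + (entropy_flux k (i - 1) - entropy_flux k i)"
proof -
  define l where "l = \<delta>t / \<delta>x"
  define c where "c = entropy_flux k"
  have l: "l > 0" using dx dt by (simp add: l_def)
  define f where "f i = r k i * w k i" for i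
  define q where "q i = Q' \<kappa> (r k i)" for i
  have inR: "r k i \<in> {0..<R}" for k i using maximum_principle[of k i] M_less_R by auto
  have c: "c i = l * q (i + 1) * f i + 2 * K * l\<^sup>2 * (f i)\<^sup>2" for i
    by (simp add: c_def entropy_flux_def l_def[symmetric] f_def q_def power2_eq_square algebra_simps)
  define D where "D = r (Suc k) i - r k i"
  have D: "D = l * (f (i - 1) - f i)" by (simp add: D_def rec f_def l_def)
  have lip: "(Q' \<kappa> y - Q' \<kappa> x) * (y - x) \<le> K * (y - x)\<^sup>2" if "x \<in> {0..M}" "y \<in> {0..M}" for x y
  proof (cases "x \<le> y")
    case True
    then show ?thesis using mult_right_mono[OF Q'_lipschitz[of x y], of "y - x"] that
      by (simp add: power2_eq_square mult.assoc)
  next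
    case False
    then show ?thesis using mult_right_mono[OF Q'_lipschitz[of y x], of "x - y"] that
      by (simp add: power2_eq_square algebra_simps)
  qed
  have "Q \<kappa> (r (Suc k) i) - Q \<kappa> (r k i) \<le> Q' \<kappa> (r (Suc k) i) * D"
    unfolding D_def by (rule Q_tangent[OF inR inR])
  also have "\<dots> \<le> q i * D + K * D\<^sup>2"
    using lip[OF maximum_principle maximum_principle, of "Suc k" i k i] by (simp add: D_def q_def algebra_simps)
  also have "D\<^sup>2 \<le> l\<^sup>2 * (2 * (f (i - 1))\<^sup>2 + 2 * (f i)\<^sup>2)"
    unfolding D power_mult_distrib
    using sum_squares_bound[of "f (i - 1)" "- f i"] by (intro mult_left_mono) (auto simp: power2_diff)
  then have "K * D\<^sup>2 \<le> K * (l\<^sup>2 * (2 * (f (i - 1))\<^sup>2 + 2 * (f i)\<^sup>2))" using K_nonneg by (rule mult_left_mono)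
  also have "q i * D + K * (l\<^sup>2 * (2 * (f (i - 1))\<^sup>2 + 2 * (f i)\<^sup>2))
      = c (i - 1) - c i + (l * (q (i + 1) - q i) * f i + 4 * K * l\<^sup>2 * (f i)\<^sup>2)"
    by (simp add: c D algebra_simps)
  finally have step: "Q \<kappa> (r (Suc k) i) - Q \<kappa> (r k i)
      \<le> c (i - 1) - c i + (l * (q (i + 1) - q i) * f i + 4 * K * l\<^sup>2 * (f i)\<^sup>2)" by linarith
  have "l * (q (i + 1) - q i) * f i + 4 * K * l\<^sup>2 * (f i)\<^sup>2 \<le> 0"
  proof -
    define v where "v = (q i - q (i + 1)) / \<delta>x"
    have w: "w k i = h v" by (simp add: w_seq_def v_def q_def)
    have v: "q (i + 1) - q i = - (\<delta>x * v)" using dx by (simp add: v_def)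
    have r: "0 \<le> r k i" "r k i \<le> M" using maximum_principle[of k i] by auto
    have "(f i)\<^sup>2 = r k i * (r k i * (h v)\<^sup>2)" by (simp add: f_def w power2_eq_square)
    also have "\<dots> \<le> r k i * (M * (H * (v * h v)))"
      using r M_nonneg h_bounds(3)[of v] by (intro mult_left_mono mult_mono) auto
    finally have "4 * K * l\<^sup>2 * (f i)\<^sup>2 \<le> 4 * K * l\<^sup>2 * (r k i * (M * (H * (v * h v))))"
      using K_nonneg by (intro mult_left_mono) auto
    also have "\<dots> = (\<delta>t * (4 * M * H / \<delta>x\<^sup>2) * K) * (\<delta>t * (r k i * (v * h v)))"
      by (simp add: l_def power2_eq_square)
    also have "\<dots> \<le> 1 * (\<delta>t * (r k i * (v * h v)))"
      using cfl2 r h_bounds(4)[of v] dt by (intro mult_right_mono) auto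
    also have "\<dots> = - (l * (q (i + 1) - q i) * f i)"
      unfolding v using dx by (simp add: l_def f_def w)
    finally show ?thesis by linarith
  qed
  with step show ?thesis unfolding c_def by linarith
qed

lemma Q_r_summable: "(\<lambda>i. Q \<kappa> (r k i)) summable_on UNIV"
proof (rule summable_on_comparison_test)
  have "\<bar>Q' \<kappa> (r k i)\<bar> \<le> Q' \<kappa> M" for i
    using maximum_principle[of k i] Q'_mono[of "r k i" M] Q'_nonneg[of "r k i"] M_less_R by auto
  then show "(\<lambda>i. r k i * Q' \<kappa> (r k i)) summable_on UNIV"
    by (rule summable_on_mult_bounded[OF r_summable[OF well_defined_of_CFL] r_nonneg[OF well_defined_of_CFL]])
  show "Q \<kappa> (r k i) \<le> r k i * Q' \<kappa> (r k i)" "0 \<le> Q \<kappa> (r k i)" for i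
    using Q_nonneg_le[OF r_range[OF well_defined_of_CFL, of k i]] by (auto simp: mult.commute)
qed

lemma entropy_decreasing: "(\<Sum>\<^sub>\<infinity>i. Q \<kappa> (r (Suc k) i)) \<le> (\<Sum>\<^sub>\<infinity>i. Q \<kappa> (r k i))"
proof -
  define l where "l = \<delta>t / \<delta>x"
  define y where "y i = l * Q' \<kappa> (r k (i + 1)) * w k i + 2 * K * l\<^sup>2 * r k i * (w k i)\<^sup>2" for i
  define c where "c = entropy_flux k"
  have c_eq: "c = (\<lambda>i. r k i * y i)" by (simp add: fun_eq_iff c_def entropy_flux_def y_def l_def)
  have l: "l > 0" using dx dt by (simp add: l_def)
  have "\<bar>y i\<bar> \<le> l * Q' \<kappa> M * (1 + b) + 2 * K * l\<^sup>2 * M * (1 + b)\<^sup>2" for i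
  proof -
    have q: "0 \<le> Q' \<kappa> (r k (i + 1))" "Q' \<kappa> (r k (i + 1)) \<le> Q' \<kappa> M"
      using maximum_principle[of k "i + 1"] Q'_mono[of "r k (i + 1)" M] Q'_nonneg[of "r k (i + 1)"] M_less_R by auto
    have "\<bar>l * Q' \<kappa> (r k (i + 1)) * w k i\<bar> \<le> l * Q' \<kappa> M * (1 + b)"
      unfolding abs_mult using q l w_bounds(2) by (intro mult_mono) auto
    moreover have "(w k i)\<^sup>2 \<le> (1 + b)\<^sup>2"
      using w_bounds(2)[of k i] b by (intro abs_le_square_iff[THEN iffD1]) auto
    then have "\<bar>2 * K * l\<^sup>2 * r k i * (w k i)\<^sup>2\<bar> \<le> 2 * K * l\<^sup>2 * M * (1 + b)\<^sup>2"
      unfolding abs_mult using maximum_principle[of k i] K_nonneg by (intro mult_mono) auto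
    ultimately show ?thesis unfolding y_def by linarith
  qed
  then have c: "c summable_on UNIV"
    unfolding c_eq by (rule summable_on_mult_bounded[OF r_summable[OF well_defined_of_CFL] r_nonneg[OF well_defined_of_CFL]])
  have "(\<Sum>\<^sub>\<infinity>i. Q \<kappa> (r (Suc k) i)) \<le> (\<Sum>\<^sub>\<infinity>i. Q \<kappa> (r k i) + (c (i - 1) - c i))"
    using discrete_entropy_inequality[of k]
    by (intro infsum_mono Q_r_summable infsum_add_flux_difference(1)[OF Q_r_summable c])
      (simp add: c_def)
  also have "\<dots> = (\<Sum>\<^sub>\<infinity>i. Q \<kappa> (r k i))"
    by (rule infsum_add_flux_difference(2)[OF Q_r_summable c])
  finally show ?thesis .
qed

text \<open>Integrability follows from \<open>0 \<le> Q(\<rho>) \<le> Q'(\<rho>) \<rho>\<close>, with \<open>Q'\<close> bounded on the range of \<open>\<rho>0\<close>.\<close>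
lemma Q_\<rho>0_integrable: "integrable lebesgue (\<lambda>x. Q \<kappa> (\<rho>0 x))"
proof -
  obtain c where c: "c < R" "\<And>x. \<rho>0 x \<le> c" using \<rho>0_bound by blast
  have c0: "0 \<le> c" using c(2)[of 0] \<rho>0_nonneg[of 0] by linarith
  have "continuous_on {0..<R} (Q \<kappa>)"
    by (rule DERIV_continuous_on[OF has_real_derivative_Q[OF R \<kappa>_cont]])
  \<comment> \<open>Clamping to \<open>[0, c]\<close> extends \<open>Q\<close> from \<open>[0, R)\<close> to a continuous function on the line.\<close>
  then have "continuous_on UNIV (\<lambda>x. Q \<kappa> (max 0 (min c x)))"
    by (rule continuous_on_compose2) (use c c0 in \<open>auto intro!: continuous_intros\<close>)
  then have "(\<lambda>x. Q \<kappa> (max 0 (min c x))) \<in> borel_measurable borel" by (rule borel_measurable_continuous_onI)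
  then have "(\<lambda>x. Q \<kappa> (max 0 (min c (\<rho>0 x)))) \<in> borel_measurable lebesgue"
    by (rule measurable_compose[OF borel_measurable_integrable[OF \<rho>0_integrable]])
  then have m: "(\<lambda>x. Q \<kappa> (\<rho>0 x)) \<in> borel_measurable lebesgue" using c(2) \<rho>0_nonneg by simp
  show ?thesis
  proof (rule Bochner_Integration.integrable_bound[OF _ m])
    show "integrable lebesgue (\<lambda>x. Q' \<kappa> c * \<rho>0 x)" using \<rho>0_integrable by simp
    show "AE x in lebesgue. norm (Q \<kappa> (\<rho>0 x)) \<le> norm (Q' \<kappa> c * \<rho>0 x)"
    proof (rule AE_I2)
      fix x
      have "\<rho>0 x < R" using c(2)[of x] c(1) by (rule order_le_less_trans)
      then have x: "\<rho>0 x \<in> {0..<R}" using \<rho>0_nonneg[of x] by simp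
      have "Q \<kappa> (\<rho>0 x) \<le> Q' \<kappa> (\<rho>0 x) * \<rho>0 x" by (rule Q_nonneg_le(2)[OF x])
      also have "\<dots> \<le> Q' \<kappa> c * \<rho>0 x" using x c by (intro mult_right_mono Q'_mono) auto
      finally show "norm (Q \<kappa> (\<rho>0 x)) \<le> norm (Q' \<kappa> c * \<rho>0 x)"
        using Q_nonneg_le(1)[OF x] by simp
    qed
  qed
qed

text \<open>Integrate the tangent inequality of \<open>Q\<close> at the cell average; its linear part has integral \<open>0\<close>.\<close>
lemma Jensen_initial: "\<delta>x * Q \<kappa> (r 0 i) \<le> (LINT x:cell \<delta>x i|lebesgue. Q \<kappa> (\<rho>0 x))"
proof -
  obtain c where c: "c < R" "\<And>x. \<rho>0 x \<le> c" using \<rho>0_bound by blast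
  let ?r = "r 0 i" and ?q = "Q' \<kappa> (r 0 i)"
  have si: "set_integrable lebesgue (cell \<delta>x i) (\<lambda>x. ?q * \<rho>0 x)"
    using \<rho>0_integrable by (intro set_integrable_cell) simp
  have "\<delta>x * Q \<kappa> ?r = (LINT x:cell \<delta>x i|lebesgue. (Q \<kappa> ?r - ?q * ?r) + ?q * \<rho>0 x)"
    using set_integral_add(2)[OF integral_const_cell(1)[OF dx, of i "Q \<kappa> ?r - ?q * ?r"] si] dx
    by (simp add: integral_const_cell(2)[OF dx] \<rho>_seq.simps(1) algebra_simps)
  also have "\<dots> \<le> (LINT x:cell \<delta>x i|lebesgue. Q \<kappa> (\<rho>0 x))"
  proof (rule set_integral_mono)
    show "set_integrable lebesgue (cell \<delta>x i) (\<lambda>x. (Q \<kappa> ?r - ?q * ?r) + ?q * \<rho>0 x)"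
      by (rule set_integral_add(1)[OF integral_const_cell(1)[OF dx] si])
    show "set_integrable lebesgue (cell \<delta>x i) (\<lambda>x. Q \<kappa> (\<rho>0 x))"
      by (rule set_integrable_cell[OF Q_\<rho>0_integrable])
    fix x
    have "\<rho>0 x < R" using c(2)[of x] c(1) by (rule order_le_less_trans)
    then have "\<rho>0 x \<in> {0..<R}" using \<rho>0_nonneg[of x] by simp
    then show "(Q \<kappa> ?r - ?q * ?r) + ?q * \<rho>0 x \<le> Q \<kappa> (\<rho>0 x)"
      using Q_tangent[of "\<rho>0 x" ?r] r_range[OF well_defined_of_CFL, of 0 i] by (simp add: algebra_simps)
  qed
  finally show ?thesis .
qed

lemma entropy_bound:
  shows "integrable lebesgue (\<lambda>x. Q \<kappa> (\<rho>_grid \<kappa> h \<delta>x \<delta>t \<rho>0 t x))"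
    "(LINT x|lebesgue. Q \<kappa> (\<rho>_grid \<kappa> h \<delta>x \<delta>t \<rho>0 t x)) \<le> (LINT x|lebesgue. Q \<kappa> (\<rho>0 x))"
proof -
  define k where "k = nat \<lfloor>t / \<delta>t\<rfloor>"
  let ?u = "\<lambda>k i. Q \<kappa> (r k i)"
  have e: "Q \<kappa> (\<rho>_grid \<kappa> h \<delta>x \<delta>t \<rho>0 t x) = ?u k \<lfloor>x / \<delta>x\<rfloor>" for x
    by (simp add: \<rho>_grid_def grid_fun_def k_def)
  have nn: "?u k i \<ge> 0" for k i by (rule Q_nonneg_le(1)[OF r_range[OF well_defined_of_CFL]])
  show "integrable lebesgue (\<lambda>x. Q \<kappa> (\<rho>_grid \<kappa> h \<delta>x \<delta>t \<rho>0 t x))"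
    unfolding e by (rule integral_step_function(1)[OF dx Q_r_summable nn])
  have \<rho>0_range: "Q \<kappa> (\<rho>0 x) \<ge> 0" for x
  proof -
    obtain c where "c < R" "\<And>x. \<rho>0 x \<le> c" using \<rho>0_bound by blast
    then have "\<rho>0 x < R" using order_le_less_trans by blast
    then show ?thesis using \<rho>0_nonneg[of x] by (intro Q_nonneg_le) auto
  qed
  have hs: "((\<lambda>i. LINT x:cell \<delta>x i|lebesgue. Q \<kappa> (\<rho>0 x)) has_sum (LINT x|lebesgue. Q \<kappa> (\<rho>0 x))) UNIV"
    by (rule has_sum_integral_cells[OF dx Q_\<rho>0_integrable \<rho>0_range])
  have "infsum (?u k) UNIV \<le> infsum (?u 0) UNIV"
    by (induction k) (use entropy_decreasing order_trans in blast)+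
  then have "\<delta>x * infsum (?u k) UNIV \<le> \<delta>x * infsum (?u 0) UNIV" using dx by simp
  also have "\<dots> = (\<Sum>\<^sub>\<infinity>i. \<delta>x * ?u 0 i)" by (simp add: infsum_cmult_right')
  also have "\<dots> \<le> (\<Sum>\<^sub>\<infinity>i. LINT x:cell \<delta>x i|lebesgue. Q \<kappa> (\<rho>0 x))"
    using hs by (intro infsum_mono summable_on_cmult_right Q_r_summable Jensen_initial)
      (auto simp: summable_on_def)
  also have "\<dots> = (LINT x|lebesgue. Q \<kappa> (\<rho>0 x))" by (rule infsumI[OF hs])
  finally show "(LINT x|lebesgue. Q \<kappa> (\<rho>_grid \<kappa> h \<delta>x \<delta>t \<rho>0 t x)) \<le> (LINT x|lebesgue. Q \<kappa> (\<rho>0 x))"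
    unfolding e by (simp only: integral_step_function(2)[OF dx Q_r_summable nn])
qed

text \<open>The infimum is approached as \<open>i \<rightarrow> \<infinity>\<close>, since the summable cell values tend to \<open>0\<close>.\<close>
lemma inf_sup_bounds:
  shows "0 = (INF x. \<rho>_grid \<kappa> h \<delta>x \<delta>t \<rho>0 t x)"
    "(INF x. \<rho>_grid \<kappa> h \<delta>x \<delta>t \<rho>0 t x) \<le> (SUP x. \<rho>_grid \<kappa> h \<delta>x \<delta>t \<rho>0 t x)"
    "(SUP x. \<rho>_grid \<kappa> h \<delta>x \<delta>t \<rho>0 t x) \<le> M"
proof -
  define k where "k = nat \<lfloor>t / \<delta>t\<rfloor>"
  let ?g = "\<rho>_grid \<kappa> h \<delta>x \<delta>t \<rho>0 t"
  have e: "?g x = r k \<lfloor>x / \<delta>x\<rfloor>" for x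
    by (simp add: \<rho>_grid_def grid_fun_def k_def)
  have g: "?g x \<in> {0..M}" for x unfolding e by (rule maximum_principle)
  have bb: "bdd_below (range ?g)" and ba: "bdd_above (range ?g)"
    using g by (auto intro!: bdd_belowI2 bdd_aboveI2)
  have lower: "0 \<le> (INF x. ?g x)" by (rule cINF_greatest) (use g in auto)
  moreover have "(INF x. ?g x) \<le> 0"
  proof (rule LIMSEQ_le_const[OF r_tendsto_zero[OF well_defined_of_CFL, of k]])
    have "(INF x. ?g x) \<le> r k (int n)" for n
      using cINF_lower[OF bb, of "of_int (int n) * \<delta>x"] dx by (simp add: e)
    then show "\<exists>N. \<forall>n\<ge>N. (INF x. ?g x) \<le> r k (int n)" by blast
  qed
  ultimately show "0 = (INF x. ?g x)" by linarith
  show "(INF x. ?g x) \<le> (SUP x. ?g x)"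
    using cINF_lower[OF bb, of 0] cSUP_upper[OF _ ba, of 0] by simp
  show "(SUP x. ?g x) \<le> M" by (rule cSUP_least) (use g in auto)
qed

end

end

section \<open>Weak form and stability of the scheme\<close>

theorem proposition6:
  fixes R b \<delta>x \<delta>t :: real
    and \<kappa> h \<beta> \<rho>0 :: "real \<Rightarrow> real"
  assumes "R > 1" and "b > 0"
    and "C1_on \<kappa> {0..<R}" and "\<And>\<rho>. \<rho> \<in> {0..<R} \<Longrightarrow> \<kappa> \<rho> \<ge> 0"
    and "\<And>\<rho>. \<rho> \<in> {0..1} \<Longrightarrow> \<kappa> \<rho> = 0" and "\<And>\<rho>. \<rho> \<in> {1<..<R} \<Longrightarrow> \<kappa> \<rho> > 0"
    and "C1_on h UNIV" and "range h = {-1<..<b}" and "in_Linf (deriv h)"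
    and "h 0 = 0" and "\<And>s. deriv h s > 0"
    and "\<And>s. \<beta> (h s) = s"
    and "\<rho>0 \<in> X_space R" and "\<delta>x > 0" and "\<delta>t > 0"
  shows
    "(well_defined R \<kappa> h \<delta>x \<delta>t \<rho>0 \<longrightarrow>
       (\<forall>t\<ge>0. integrable lebesgue (\<rho>_grid \<kappa> h \<delta>x \<delta>t \<rho>0 t) \<and>
          (LINT x|lebesgue. \<rho>_grid \<kappa> h \<delta>x \<delta>t \<rho>0 t x) = (LINT x|lebesgue. \<rho>0 x)) \<and>
       (\<forall>\<phi>. C2_halfplane \<phi> \<and> compact_support_halfplane \<phi> \<longrightarrow>
          - (LINT x|lebesgue. \<phi> 0 x * \<rho>0 x) =
            (LINT t:{0..}|lebesgue. LINT x|lebesgue.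
               \<rho>_grid \<kappa> h \<delta>x \<delta>t \<rho>0 t x *
                 (w_grid \<kappa> h \<delta>x \<delta>t \<rho>0 t x * D_x \<phi> t x + D_t \<phi> t x))
            + P1 \<kappa> h \<delta>x \<delta>t \<rho>0 \<phi> \<and>
          (LINT t:{0..}|lebesgue. LINT x|lebesgue.
             \<phi> t x * \<beta> (w_grid \<kappa> h \<delta>x \<delta>t \<rho>0 t x)
             - D_x \<phi> t x * Q' \<kappa> (\<rho>_grid \<kappa> h \<delta>x \<delta>t \<rho>0 t x))
            = P2 \<kappa> h \<beta> \<delta>x \<delta>t \<rho>0 \<phi>)) \<and>
    (1 \<ge> \<delta>t / \<delta>x * (b + 2 * (linf_norm \<rho>0 * linf_norm (deriv h) / \<delta>x)
             * (SUP \<rho>\<in>{0..linf_norm \<rho>0}. \<kappa> \<rho>)) \<and>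
      1 \<ge> \<delta>t * (4 * linf_norm \<rho>0 * linf_norm (deriv h) / \<delta>x\<^sup>2)
             * (SUP \<rho>\<in>{0..linf_norm \<rho>0}. \<kappa> \<rho>) \<longrightarrow>
       well_defined R \<kappa> h \<delta>x \<delta>t \<rho>0 \<and>
       (\<forall>t\<ge>0.
          integrable lebesgue (\<lambda>x. Q \<kappa> (\<rho>_grid \<kappa> h \<delta>x \<delta>t \<rho>0 t x)) \<and>
          integrable lebesgue (\<lambda>x. Q \<kappa> (\<rho>0 x)) \<and>
          (LINT x|lebesgue. Q \<kappa> (\<rho>_grid \<kappa> h \<delta>x \<delta>t \<rho>0 t x)) \<le> (LINT x|lebesgue. Q \<kappa> (\<rho>0 x)) \<and>
          0 = (INF x. \<rho>_grid \<kappa> h \<delta>x \<delta>t \<rho>0 t x) \<and>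
          (INF x. \<rho>_grid \<kappa> h \<delta>x \<delta>t \<rho>0 t x) \<le> (SUP x. \<rho>_grid \<kappa> h \<delta>x \<delta>t \<rho>0 t x) \<and>
          (SUP x. \<rho>_grid \<kappa> h \<delta>x \<delta>t \<rho>0 t x) \<le> linf_norm \<rho>0))"
proof -
  interpret scheme: traffic_scheme R b \<delta>x \<delta>t \<kappa> h \<rho>0
    using assms by unfold_locales auto
  have weak: "- (LINT x|lebesgue. \<phi> 0 x * \<rho>0 x) =
        (LINT t:{0..}|lebesgue. LINT x|lebesgue.
           \<rho>_grid \<kappa> h \<delta>x \<delta>t \<rho>0 t x *
             (w_grid \<kappa> h \<delta>x \<delta>t \<rho>0 t x * D_x \<phi> t x + D_t \<phi> t x))
        + P1 \<kappa> h \<delta>x \<delta>t \<rho>0 \<phi> \<and>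
      (LINT t:{0..}|lebesgue. LINT x|lebesgue.
         \<phi> t x * \<beta> (w_grid \<kappa> h \<delta>x \<delta>t \<rho>0 t x)
         - D_x \<phi> t x * Q' \<kappa> (\<rho>_grid \<kappa> h \<delta>x \<delta>t \<rho>0 t x))
        = P2 \<kappa> h \<beta> \<delta>x \<delta>t \<rho>0 \<phi>"
    if "C2_halfplane \<phi>" and supp: "compact_support_halfplane \<phi>" for \<phi>
  proof -
    obtain N where "vanishes_beyond \<delta>x \<delta>t N \<phi>" "vanishes_beyond \<delta>x \<delta>t N (D_t \<phi>)"
      "vanishes_beyond \<delta>x \<delta>t N (D_x \<phi>)"
      using compact_support_vanishes[OF supp \<open>\<delta>x > 0\<close> \<open>\<delta>t > 0\<close>] by blast
    then interpret test: scheme_test_function \<kappa> h \<rho>0 \<delta>x \<delta>t \<phi> N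
      using assms that by unfold_locales
    show ?thesis
      using test.weak_continuity_equation[OF scheme.\<rho>0_integrable]
        test.weak_velocity_equation[OF \<open>\<And>s. \<beta> (h s) = s\<close>] by blast
  qed
  show ?thesis
    using weak scheme.mass_conservation scheme.well_defined_of_CFL scheme.entropy_bound
      scheme.Q_\<rho>0_integrable scheme.inf_sup_bounds by blast
qed

end
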